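(* Let $2\le d\le4$, let $\mathcal O\subset\mathbb R^d$ be a domain as in the context, let $\mu>0$, $\beta>0$, $p\ge2$, and set $\mathscr H(\boldsymbol x)=\mu\mathcal A(\boldsymbol x)+\mathrm B(\boldsymbol x)+\beta\mathcal C(\boldsymbol x)$. (1) If $r>4$, then for all $\boldsymbol x,\boldsymbol y\in\mathbb V_p\cap\widetilde{\mathbb L}^r$, $$\langle\mathscr H(\boldsymbol x)-\mathscr H(\boldsymbol y),\boldsymbol x-\boldsymbol y\rangle+\eta\|\boldsymbol x-\boldsymbol y\|_{\mathbb H}^2\ge0,\qquad \eta=\frac{r-4}{2\mu(r-2)}\Big(\frac{2}{\beta\mu(r-2)}\Big)^{\frac{2}{r-4}},$$ that is, $\mathscr H+\eta\mathrm I$ is a monotone operator from $\mathbb V_p\cap\widetilde{\mathbb L}^r$ to $\mathbb V_p'+\widetilde{\mathbb L}^{\frac r{r-1}}$. (2) If $r=4$ and $2\beta\mu\ge1$, then $\mathscr H:\mathbb V_p\cap\widetilde{\mathbb L}^4\to\mathbb V_p'+\widetilde{\mathbb L}^{\frac43}$ is globally monotone, that is, for all $\boldsymbol x,\boldsymbol y\in\mathbb V_p\cap\widetilde{\mathbb L}^4$, $$\langle\mathscr H(\boldsymbol x)-\mathscr H(\boldsymbol y),\boldsymbol x-\boldsymbol y\rangle\ge0.$$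
   Context: Domain. $\mathcal O\subset\mathbb R^d$ ($2\le d\le4$) is open and connected, possibly unbounded, with boundary uniformly of class $\mathrm C^2$, and for every $p\in[1,\infty)$ there is $\lambda_{1,p}>0$ with $\lambda_{1,p}\int_{\mathcal O}|\psi|^p\,\mathrm dx\le\int_{\mathcal O}|\nabla\psi|^p\,\mathrm dx$ for all $\psi\in \mathrm W_0^{1,p}(\mathcal O;\mathbb R^d)$. Spaces. $\mathscr V=\{\boldsymbol u\in \mathrm C_0^\infty(\mathcal O;\mathbb R^d):\nabla\cdot\boldsymbol u=0\}$. $\mathbb H$, $\mathbb V$, $\widetilde{\mathbb L}^r$, $\mathbb V_p$ are the closures of $\mathscr V$ in $\mathrm L^2(\mathcal O;\mathbb R^d)$, $\mathrm H_0^1(\mathcal O;\mathbb R^d)$, $\mathrm L^r(\mathcal O;\mathbb R^d)$, $\mathrm W_0^{1,p}(\mathcal O;\mathbb R^d)$, with norms $\|\boldsymbol u\|_{\mathbb H}=\|\boldsymbol u\|_{\mathrm L^2}$, $\|\boldsymbol u\|_{\mathbb V}=\|\nabla\boldsymbol u\|_{\mathrm L^2}$, $\|\boldsymbol u\|_{\widetilde{\mathbb L}^r}=\|\boldsymbol u\|_{\mathrm L^r}$, $\|\boldsymbol u\|_{\mathbb V_p}=\|\nabla\boldsymbol u\|_{\mathrm L^p}$. The continuous embeddings $\mathbb V_p\hookrightarrow\mathbb V$ and $\mathbb V_p\cap\widetilde{\mathbb L}^r\hookrightarrow\mathbb H\equiv\mathbb H'\hookrightarrow\mathbb V_p'+\widetilde{\mathbb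 L}^{r/(r-1)}$ are in force (with $\widetilde{\mathbb L}^{r/(r-1)}$ identified with the dual of $\widetilde{\mathbb L}^r$), and $\langle\cdot,\cdot\rangle$ is the pairing between $\mathbb V_p'+\widetilde{\mathbb L}^{r/(r-1)}$ and $\mathbb V_p\cap\widetilde{\mathbb L}^r$. Operators. $\langle\mathcal A(\boldsymbol x),\boldsymbol y\rangle=\int_{\mathcal O}(1+|\nabla\boldsymbol x|^2)^{\frac{p-2}2}\nabla\boldsymbol x:\nabla\boldsymbol y\,\mathrm dx$; $\langle\mathrm B(\boldsymbol x),\boldsymbol y\rangle=\int_{\mathcal O}(\boldsymbol x\cdot\nabla)\boldsymbol x\cdot\boldsymbol y\,\mathrm dx$; $\langle\mathcal C(\boldsymbol x),\boldsymbol y\rangle=\int_{\mathcal O}|\boldsymbol x|^{r-2}\boldsymbol x\cdot\boldsymbol y\,\mathrm dx$, for $\boldsymbol x,\boldsymbol y\in\mathbb V_p\cap\widetilde{\mathbb L}^r$. *)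

theory Defs
  imports "HOL-Analysis.Analysis"
begin

section \<open>Smooth functions and domains\<close>

text \<open>Class \<open>C\<^sup>k\<close> on an open set, by iterated partial derivatives. Differentiability is required
  at each stage, which for \<open>k \<ge> 1\<close> yields the continuity of all derivatives of lower order.\<close>

primrec Ck_on :: "nat \<Rightarrow> 'a::euclidean_space set \<Rightarrow> ('a \<Rightarrow> 'b::real_normed_vector) \<Rightarrow> bool" where
  "Ck_on 0 S f \<longleftrightarrow> continuous_on S f"
| "Ck_on (Suc k) S f \<longleftrightarrow>
     (\<forall>x\<in>S. f differentiable (at x)) \<and>
     (\<forall>b\<in>Basis. Ck_on k S (\<lambda>x. frechet_derivative f (at x) b))"

definition test_functions :: "'a::euclidean_space set \<Rightarrow> ('a \<Rightarrow> 'b::real_normed_vector) set" where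
  "test_functions \<Omega> =
     {\<phi>. (\<forall>k. Ck_on k UNIV \<phi>) \<and> compact (closure {x. \<phi> x \<noteq> 0}) \<and> closure {x. \<phi> x \<noteq> 0} \<subseteq> \<Omega>}"

text \<open>Uniform \<open>C\<^sup>2\<close>-regularity of the boundary: near each boundary point \<open>x0\<close> the set lies on one side of
  a \<open>C\<^sup>2\<close> graph, where the size \<open>(\<alpha>, \<beta>)\<close> of the cylindrical neighbourhood and the bound \<open>K\<close> on the
  \<open>C\<^sup>2\<close>-norm of the graph function do not depend on \<open>x0\<close>. A local Cartesian coordinate system
  \<open>(y', y\<^sub>d)\<close> with origin \<open>x0\<close> is encoded by the unit vector \<open>n\<close> of its last axis: for \<open>z = x - x0\<close>,
  \<open>y\<^sub>d = z \<bullet> n\<close> and \<open>y'\<close> is the component of \<open>z\<close> orthogonal to \<open>n\<close>. A function \<open>h\<close> of \<open>y'\<close> alone is a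
  function of \<open>z\<close> that is invariant under translation along \<open>n\<close>.\<close>

definition uniformly_C2_boundary :: "'a::euclidean_space set \<Rightarrow> bool" where
  "uniformly_C2_boundary \<Omega> \<longleftrightarrow>
     (\<exists>\<alpha>>0. \<exists>\<beta>>0. \<exists>K. \<forall>x0\<in>frontier \<Omega>. \<exists>n. \<exists>h::'a \<Rightarrow> real.
        norm n = 1 \<and>
        (\<forall>z t. h (z + t *\<^sub>R n) = h z) \<and>
        (let D = {z. norm (z - (z \<bullet> n) *\<^sub>R n) < \<alpha>} in
           Ck_on 2 D h \<and>
           (\<forall>z\<in>D. \<bar>h z\<bar> \<le> K \<and>
              (\<forall>b\<in>Basis. \<bar>frechet_derivative h (at z) b\<bar> \<le> K) \<and>
              (\<forall>b\<in>Basis. \<forall>c\<in>Basis.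
                 \<bar>frechet_derivative (\<lambda>w. frechet_derivative h (at w) b) (at z) c\<bar> \<le> K)) \<and>
           (\<forall>z\<in>D. \<bar>z \<bullet> n - h z\<bar> < \<beta> \<longrightarrow>
              (x0 + z \<in> \<Omega> \<longleftrightarrow> z \<bullet> n < h z) \<and>
              (x0 + z \<in> frontier \<Omega> \<longleftrightarrow> z \<bullet> n = h z))))"

section \<open>Lebesgue and Sobolev spaces\<close>

text \<open>The elements of all function spaces below are functions rather than classes modulo equality
  almost everywhere (only their values on \<open>\<Omega>\<close> matter), so the norms are seminorms on functions.\<close>

definition Lp_space :: "'a::euclidean_space set \<Rightarrow> real \<Rightarrow> ('a \<Rightarrow> 'b::euclidean_space) set" where
  "Lp_space \<Omega> q =
     {f. f \<in> borel_measurable (lebesgue_on \<Omega>) \<and> integrable (lebesgue_on \<Omega>) (\<lambda>x. norm (f x) powr q)}"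

definition Lp_norm :: "'a::euclidean_space set \<Rightarrow> real \<Rightarrow> ('a \<Rightarrow> 'b::euclidean_space) \<Rightarrow> real" where
  "Lp_norm \<Omega> q f = (LINT x|lebesgue_on \<Omega>. norm (f x) powr q) powr (1 / q)"

definition locally_integrable_on :: "('a::euclidean_space \<Rightarrow> 'b::euclidean_space) \<Rightarrow> 'a set \<Rightarrow> bool" where
  "locally_integrable_on f \<Omega> \<longleftrightarrow> (\<forall>K. compact K \<and> K \<subseteq> \<Omega> \<longrightarrow> f absolutely_integrable_on K)"

text \<open>Convention: the \<open>(i, j)\<close> entry of \<open>\<nabla>u\<close> is \<open>\<partial>\<^sub>j u\<^sub>i\<close>. The norm and the inner product of
  \<^typ>\<open>real^'d^'d\<close> are the Frobenius ones, so \<open>\<nabla>u \<bullet> \<nabla>v\<close> is \<open>\<nabla>u : \<nabla>v\<close>.\<close>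

definition has_weak_gradient_on ::
  "(real^'d \<Rightarrow> real^'d) \<Rightarrow> (real^'d \<Rightarrow> real^'d^'d) \<Rightarrow> (real^'d) set \<Rightarrow> bool" where
  "has_weak_gradient_on u G \<Omega> \<longleftrightarrow>
     locally_integrable_on u \<Omega> \<and> locally_integrable_on G \<Omega> \<and>
     (\<forall>\<phi>::real^'d \<Rightarrow> real. \<phi> \<in> test_functions \<Omega> \<longrightarrow>
        (\<forall>i j. (LINT x|lebesgue_on \<Omega>. u x $ i * frechet_derivative \<phi> (at x) (axis j 1)) =
               - (LINT x|lebesgue_on \<Omega>. G x $ i $ j * \<phi> x)))"

text \<open>The weak gradient is unique up to a null set; an arbitrary representative is chosen.\<close>

definition weak_grad :: "(real^'d) set \<Rightarrow> (real^'d \<Rightarrow> real^'d) \<Rightarrow> real^'d \<Rightarrow> real^'d^'d" where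
  "weak_grad \<Omega> u = (SOME G. has_weak_gradient_on u G \<Omega>)"

definition W1p_space :: "(real^'d) set \<Rightarrow> real \<Rightarrow> (real^'d \<Rightarrow> real^'d) set" where
  "W1p_space \<Omega> q =
     {u. u \<in> Lp_space \<Omega> q \<and> (\<exists>G. has_weak_gradient_on u G \<Omega>) \<and> weak_grad \<Omega> u \<in> Lp_space \<Omega> q}"

definition W1p_norm :: "(real^'d) set \<Rightarrow> real \<Rightarrow> (real^'d \<Rightarrow> real^'d) \<Rightarrow> real" where
  "W1p_norm \<Omega> q u = (Lp_norm \<Omega> q u powr q + Lp_norm \<Omega> q (weak_grad \<Omega> u) powr q) powr (1 / q)"

definition norm_closure_in ::
  "('a \<Rightarrow> 'b::real_vector) set \<Rightarrow> (('a \<Rightarrow> 'b) \<Rightarrow> real) \<Rightarrow> ('a \<Rightarrow> 'b) set \<Rightarrow> ('a \<Rightarrow> 'b) set" where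
  "norm_closure_in X N A = {u \<in> X. \<forall>\<epsilon>>0. \<exists>\<phi>\<in>A. N (\<lambda>x. u x - \<phi> x) < \<epsilon>}"

definition W01p_space :: "(real^'d) set \<Rightarrow> real \<Rightarrow> (real^'d \<Rightarrow> real^'d) set" where
  "W01p_space \<Omega> q = norm_closure_in (W1p_space \<Omega> q) (W1p_norm \<Omega> q) (test_functions \<Omega>)"

definition admissible_domain :: "(real^'d) set \<Rightarrow> bool" where
  "admissible_domain \<Omega> \<longleftrightarrow>
     open \<Omega> \<and> connected \<Omega> \<and> uniformly_C2_boundary \<Omega> \<and>
     (\<forall>q\<ge>1. \<exists>c>0. \<forall>\<psi>\<in>W01p_space \<Omega> q.
        c * (LINT x|lebesgue_on \<Omega>. norm (\<psi> x) powr q)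
          \<le> (LINT x|lebesgue_on \<Omega>. norm (weak_grad \<Omega> \<psi> x) powr q))"

section \<open>Spaces of divergence-free fields\<close>

definition divergence :: "(real^'d \<Rightarrow> real^'d) \<Rightarrow> real^'d \<Rightarrow> real" where
  "divergence u x = (\<Sum>i\<in>UNIV. frechet_derivative u (at x) (axis i 1) $ i)"

definition solenoidal_tests :: "(real^'d) set \<Rightarrow> (real^'d \<Rightarrow> real^'d) set" where
  "solenoidal_tests \<Omega> = {u \<in> test_functions \<Omega>. \<forall>x\<in>\<Omega>. divergence u x = 0}"

definition L_sol :: "(real^'d) set \<Rightarrow> real \<Rightarrow> (real^'d \<Rightarrow> real^'d) set" where
  "L_sol \<Omega> r = norm_closure_in (Lp_space \<Omega> r) (Lp_norm \<Omega> r) (solenoidal_tests \<Omega>)"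

definition H_sol :: "(real^'d) set \<Rightarrow> (real^'d \<Rightarrow> real^'d) set" where
  "H_sol \<Omega> = L_sol \<Omega> 2"

definition H_norm :: "(real^'d) set \<Rightarrow> (real^'d \<Rightarrow> real^'d) \<Rightarrow> real" where
  "H_norm \<Omega> = Lp_norm \<Omega> 2"

definition V_sol :: "(real^'d) set \<Rightarrow> real \<Rightarrow> (real^'d \<Rightarrow> real^'d) set" where
  "V_sol \<Omega> p = norm_closure_in (W01p_space \<Omega> p) (W1p_norm \<Omega> p) (solenoidal_tests \<Omega>)"

definition V_norm :: "(real^'d) set \<Rightarrow> real \<Rightarrow> (real^'d \<Rightarrow> real^'d) \<Rightarrow> real" where
  "V_norm \<Omega> p u = Lp_norm \<Omega> p (weak_grad \<Omega> u)"

text \<open>The case \<open>p = 2\<close> is the space usually denoted by \<open>V\<close>, and \<open>X_sol\<close> below is \<open>V\<^sub>p \<inter> L\<^sup>r\<close>.\<close>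

definition X_sol :: "(real^'d) set \<Rightarrow> real \<Rightarrow> real \<Rightarrow> (real^'d \<Rightarrow> real^'d) set" where
  "X_sol \<Omega> p r = V_sol \<Omega> p \<inter> L_sol \<Omega> r"

definition X_norm :: "(real^'d) set \<Rightarrow> real \<Rightarrow> real \<Rightarrow> (real^'d \<Rightarrow> real^'d) \<Rightarrow> real" where
  "X_norm \<Omega> p r u = V_norm \<Omega> p u + Lp_norm \<Omega> r u"

definition continuously_embedded :: "'f set \<Rightarrow> ('f \<Rightarrow> real) \<Rightarrow> 'f set \<Rightarrow> ('f \<Rightarrow> real) \<Rightarrow> bool" where
  "continuously_embedded X M Y N \<longleftrightarrow> X \<subseteq> Y \<and> (\<exists>C. \<forall>u\<in>X. N u \<le> C * M u)"

section \<open>Duals and operators\<close>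

text \<open>A functional on a space of functions is given by its values on that space only. Boundedness
  makes it constant on classes of functions that agree almost everywhere.\<close>

definition dual_of ::
  "('a \<Rightarrow> 'b::real_vector) set \<Rightarrow> (('a \<Rightarrow> 'b) \<Rightarrow> real) \<Rightarrow> (('a \<Rightarrow> 'b) \<Rightarrow> real) set" where
  "dual_of X N =
     {l. (\<forall>u\<in>X. \<forall>v\<in>X. \<forall>a b. l (\<lambda>x. a *\<^sub>R u x + b *\<^sub>R v x) = a * l u + b * l v) \<and>
         (\<exists>C. \<forall>u\<in>X. \<bar>l u\<bar> \<le> C * N u)}"

text \<open>The sum of the duals of \<open>V_sol \<Omega> p\<close> and \<open>L_sol \<Omega> r\<close>, as functionals on \<open>X_sol \<Omega> p r\<close>; the dual
  of \<open>L_sol \<Omega> r\<close> is the space written as \<open>L_sol \<Omega> (r / (r - 1))\<close> by the usual identification.\<close>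

definition X_dual :: "(real^'d) set \<Rightarrow> real \<Rightarrow> real \<Rightarrow> ((real^'d \<Rightarrow> real^'d) \<Rightarrow> real) set" where
  "X_dual \<Omega> p r =
     {l. \<exists>f\<in>dual_of (V_sol \<Omega> p) (V_norm \<Omega> p). \<exists>g\<in>dual_of (L_sol \<Omega> r) (Lp_norm \<Omega> r).
           \<forall>y\<in>X_sol \<Omega> p r. l y = f y + g y}"

text \<open>The operators take values in functionals: \<open>op x y\<close> is the pairing of \<open>op x\<close> with \<open>y\<close>.\<close>

definition op_A :: "(real^'d) set \<Rightarrow> real \<Rightarrow> (real^'d \<Rightarrow> real^'d) \<Rightarrow> (real^'d \<Rightarrow> real^'d) \<Rightarrow> real" where
  "op_A \<Omega> p x y =
     (LINT \<xi>|lebesgue_on \<Omega>. (1 + (norm (weak_grad \<Omega> x \<xi>))\<^sup>2) powr ((p - 2) / 2) *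
        (weak_grad \<Omega> x \<xi> \<bullet> weak_grad \<Omega> y \<xi>))"

text \<open>With the above convention for \<open>\<nabla>\<close>, \<open>(x \<cdot> \<nabla>)x\<close> is the matrix-vector product \<open>(\<nabla>x) x\<close>.\<close>

definition op_B :: "(real^'d) set \<Rightarrow> (real^'d \<Rightarrow> real^'d) \<Rightarrow> (real^'d \<Rightarrow> real^'d) \<Rightarrow> real" where
  "op_B \<Omega> x y = (LINT \<xi>|lebesgue_on \<Omega>. (weak_grad \<Omega> x \<xi> *v x \<xi>) \<bullet> y \<xi>)"

definition op_C :: "(real^'d) set \<Rightarrow> real \<Rightarrow> (real^'d \<Rightarrow> real^'d) \<Rightarrow> (real^'d \<Rightarrow> real^'d) \<Rightarrow> real" where
  "op_C \<Omega> r x y = (LINT \<xi>|lebesgue_on \<Omega>. norm (x \<xi>) powr (r - 2) * (x \<xi> \<bullet> y \<xi>))"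

definition op_I :: "(real^'d) set \<Rightarrow> (real^'d \<Rightarrow> real^'d) \<Rightarrow> (real^'d \<Rightarrow> real^'d) \<Rightarrow> real" where
  "op_I \<Omega> x y = (LINT \<xi>|lebesgue_on \<Omega>. x \<xi> \<bullet> y \<xi>)"

definition op_H ::
  "(real^'d) set \<Rightarrow> real \<Rightarrow> real \<Rightarrow> real \<Rightarrow> real \<Rightarrow>
     (real^'d \<Rightarrow> real^'d) \<Rightarrow> (real^'d \<Rightarrow> real^'d) \<Rightarrow> real" where
  "op_H \<Omega> \<mu> \<beta> p r x y = \<mu> * op_A \<Omega> p x y + op_B \<Omega> x y + \<beta> * op_C \<Omega> r x y"

definition monotone_operator ::
  "('a \<Rightarrow> 'b::real_vector) set \<Rightarrow> (('a \<Rightarrow> 'b) \<Rightarrow> real) set \<Rightarrow>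
     (('a \<Rightarrow> 'b) \<Rightarrow> ('a \<Rightarrow> 'b) \<Rightarrow> real) \<Rightarrow> bool" where
  "monotone_operator X Y T \<longleftrightarrow>
     (\<forall>x\<in>X. T x \<in> Y) \<and>
     (\<forall>x\<in>X. \<forall>y\<in>X. T x (\<lambda>\<xi>. x \<xi> - y \<xi>) - T y (\<lambda>\<xi>. x \<xi> - y \<xi>) \<ge> 0)"

end

theory Submission
  imports Defs
begin

text \<open>With \<open>w = x - y\<close>, the weight of \<open>A\<close> is increasing and at least \<open>1\<close>, so the viscous part of
  \<open>\<langle>H x - H y, w\<rangle>\<close> is at least \<open>\<mu> \<parallel>\<nabla>w\<parallel>\<^sup>2\<close>, and the damping part is at least \<open>(\<beta>/2) \<integral>|y|\<^sup>r\<^sup>-\<^sup>2 |w|\<^sup>2\<close>.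
  Antisymmetry of the trilinear form \<open>b(z, u, v) = \<integral>((\<nabla>u) z) \<bullet> v\<close> in \<open>(u, v)\<close> reduces the convective part to
  \<open>- b(w, w, y)\<close>, which is at most \<open>\<mu> \<parallel>\<nabla>w\<parallel>\<^sup>2 + \<integral>|y|\<^sup>2 |w|\<^sup>2 / (4\<mu>)\<close> in absolute value, and Young's inequality absorbs
  the last integral into the damping and the \<open>\<eta>\<close>-term.

  Antisymmetry needs no approximation that converges in \<open>V\<^sub>p\<close> and \<open>L\<^sup>r\<close> simultaneously, nor a Sobolev embedding:
  \<open>z\<close> is approximated in \<open>L\<^sup>r\<close> only, since \<open>|\<nabla>u| |v|\<close> lies in the dual \<open>(L\<^sup>r)'\<close> for \<open>r \<ge> 4\<close>, and for a fixed
  solenoidal test function \<open>z\<close> it suffices to approximate \<open>v\<close> in \<open>W\<^sup>1\<^sup>,\<^sup>2\<close>.\<close>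

section \<open>Smooth functions and the fundamental lemma of the calculus of variations\<close>

text \<open>\<open>weak_grad\<close> is an arbitrarily chosen representative, so even the gradient
  of \<open>x - y\<close> is tied to those of \<open>x\<close> and \<open>y\<close> only almost
  everywhere, through uniqueness of weak gradients. Uniqueness is the fundamental lemma of the
  calculus of variations, which is why explicit smooth bump functions are built. Likewise the
  approximants in the closures come with classical gradients, and these are weak gradients only by
  an integration by parts.

  The exponent 4 enters twice. The product |grad u| |v| lies in the dual of L^r if v is in L^s with
  1/2 + 1/s = 1 - 1/r, and for r > 2 the solution s = 2r/(r - 2) is at most r exactly when r >= 4.
  Moreover |y|^2 is dominated by a multiple of |y|^(r-2) plus a constant when r > 4; at r = 4 the
  two powers coincide, no constant can help, and the coefficients 1/(4 \<mu>) and \<beta>/2 have to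
  be compared directly. This is the condition 2 \<beta> \<mu> >= 1.\<close>

lemma Ck_on_SucD: "Ck_on (Suc k) UNIV f \<Longrightarrow> Ck_on k UNIV f"
proof (induction k arbitrary: f)
  case 0
  then show ?case
    by (auto intro!: differentiable_imp_continuous_on simp: differentiable_on_def)
next
  case (Suc k)
  have d: "\<forall>x\<in>UNIV. f differentiable (at x)"
    and "\<forall>b\<in>Basis. Ck_on (Suc k) UNIV (\<lambda>x. frechet_derivative f (at x) b)"
    using Suc.prems unfolding Ck_on.simps(2)[of "Suc k"] by blast+
  then have "\<forall>b\<in>Basis. Ck_on k UNIV (\<lambda>x. frechet_derivative f (at x) b)"
    using Suc.IH by blast
  with d show ?case by (simp only: Ck_on.simps(2))
qed

lemma Ck_on_const: "Ck_on k UNIV (\<lambda>x. c)"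
proof (induction k arbitrary: c)
  case (Suc k)
  then show ?case by (simp add: frechet_derivative_const)
qed simp

text \<open>Any known derivative may stand in for \<open>frechet_derivative\<close>, so the
  inductions below can follow the usual differentiation rules.\<close>

lemma Ck_on_Suc_I:
  assumes "\<And>x. (f has_derivative f' x) (at x)" "\<And>b. b \<in> Basis \<Longrightarrow> Ck_on k UNIV (\<lambda>x. f' x b)"
  shows "Ck_on (Suc k) UNIV f"
proof -
  have "f' x = frechet_derivative f (at x)" for x
    using assms(1) by (rule frechet_derivative_at)
  with assms show ?thesis by (auto simp: differentiable_def)
qed

lemma Ck_on_Suc_E:
  assumes "Ck_on (Suc k) UNIV f"
  shows "(f has_derivative frechet_derivative f (at x)) (at x)"
    and "b \<in> Basis \<Longrightarrow> Ck_on k UNIV (\<lambda>x. frechet_derivative f (at x) b)"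
  using assms frechet_derivative_works by auto

lemma Ck_on_add:
  "Ck_on k UNIV f \<Longrightarrow> Ck_on k UNIV g \<Longrightarrow> Ck_on k UNIV (\<lambda>x. f x + g x)"
proof (induction k arbitrary: f g)
  case 0
  then show ?case by (auto intro: continuous_on_add)
next
  case (Suc k)
  show ?case
    by (rule Ck_on_Suc_I[OF has_derivative_add[OF Suc.prems[THEN Ck_on_Suc_E(1)]]])
      (intro Suc.IH Suc.prems[THEN Ck_on_Suc_E(2)])
qed

lemma Ck_on_mult:
  fixes f g :: "'a::euclidean_space \<Rightarrow> real"
  shows "Ck_on k UNIV f \<Longrightarrow> Ck_on k UNIV g \<Longrightarrow> Ck_on k UNIV (\<lambda>x. f x * g x)"
proof (induction k arbitrary: f g)
  case 0
  then show ?case by (auto intro: continuous_on_mult)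
next
  case (Suc k)
  \<comment> \<open>The product rule leaves one factor undifferentiated, with one order to spare;
    \<open>Ck_on_SucD\<close> lowers it so that the induction hypothesis applies.\<close>
  show ?case
    by (rule Ck_on_Suc_I[OF has_derivative_mult[OF Suc.prems[THEN Ck_on_Suc_E(1)]]])
      (intro Ck_on_add Suc.IH Suc.prems[THEN Ck_on_Suc_E(2)] Suc.prems[THEN Ck_on_SucD])
qed

lemma Ck_on_prod:
  fixes f :: "'i \<Rightarrow> 'a::euclidean_space \<Rightarrow> real"
  shows "(\<And>i. i \<in> I \<Longrightarrow> Ck_on k UNIV (f i)) \<Longrightarrow> Ck_on k UNIV (\<lambda>x. \<Prod>i\<in>I. f i x)"
  by (induction I rule: infinite_finite_induct) (auto intro: Ck_on_const Ck_on_mult)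

lemma Ck_on_bounded_linear:
  assumes L: "bounded_linear L"
  shows "Ck_on k UNIV f \<Longrightarrow> Ck_on k UNIV (\<lambda>x. L (f x))"
proof (induction k arbitrary: f)
  case 0
  show ?case using bounded_linear.continuous_on[OF L] 0 by simp
next
  case (Suc k)
  show ?case
    by (rule Ck_on_Suc_I[OF bounded_linear.has_derivative[OF L Suc.prems[THEN Ck_on_Suc_E(1)]]])
      (intro Suc.IH Suc.prems[THEN Ck_on_Suc_E(2)])
qed

section \<open>Smooth bump functions on boxes\<close>

text \<open>Unlike \<open>exp (- (1 / t))\<close> alone, this family is closed under differentiation, so smoothness is an induction.\<close>

definition exp_bump :: "real poly \<Rightarrow> real \<Rightarrow> real" where
  "exp_bump P t = (if t > 0 then poly P (1 / t) * exp (- (1 / t)) else 0)"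

text \<open>With s = 1 / t this is the decay for t tending to 0 from the right that makes every
  \<open>exp_bump P\<close> flat at 0.\<close>

lemma poly_times_exp_minus_tendsto_0:
  fixes P :: "real poly"
  shows "((\<lambda>s. poly P s * exp (- s)) \<longlongrightarrow> 0) at_top"
proof -
  have "((\<lambda>s. \<Sum>i\<le>degree P. coeff P i * (s ^ i / exp s)) \<longlongrightarrow> (\<Sum>i\<le>degree P. coeff P i * 0)) at_top"
    by (intro tendsto_intros tendsto_power_div_exp_0)
  then show ?thesis
    by (simp add: poly_altdef exp_minus sum_distrib_right divide_inverse mult.assoc)
qed

text \<open>For s = 1 / t the chain rule gives d/dt = - s^2 d/ds, and d/ds (P exp (- s)) = (P' - P)
  exp (- s); hence the polynomial s^2 (P - P').\<close>

lemma exp_bump_deriv: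
  "(exp_bump P has_real_derivative exp_bump ([:0, 0, 1:] * (P - pderiv P)) t) (at t)"
proof (cases "t = 0")
  case False
  show ?thesis
  proof (cases "t > 0")
    case True
    have "((\<lambda>t. poly P (1 / t) * exp (- (1 / t))) has_real_derivative
             exp_bump ([:0, 0, 1:] * (P - pderiv P)) t) (at t)"
      using True unfolding exp_bump_def
      by (auto intro!: derivative_eq_intros DERIV_chain2[OF poly_DERIV] simp: field_simps power2_eq_square)
    then show ?thesis
      by (rule DERIV_cong_ev[THEN iffD1, rotated 3])
        (use True in \<open>auto simp: exp_bump_def intro!: eventually_mono[OF eventually_gt_at_top] eventually_nhds_in_open[of "{0<..}", THEN eventually_mono]\<close>)
  next
    case neg: False
    have "((\<lambda>t. 0) has_real_derivative exp_bump ([:0, 0, 1:] * (P - pderiv P)) t) (at t)"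
      using neg unfolding exp_bump_def by simp
    then show ?thesis
      by (rule DERIV_cong_ev[THEN iffD1, rotated 3])
        (use neg False in \<open>auto simp: exp_bump_def intro!: eventually_nhds_in_open[of "{..<0}", THEN eventually_mono]\<close>)
  qed
next
  case True
  \<comment> \<open>The difference quotient at 0 has an extra factor 1 / h, which is absorbed by
    multiplying \<open>P\<close> by the variable, that is, by \<open>pCons 0 P\<close>.\<close>
  have "((\<lambda>s. poly (pCons 0 P) s * exp (- s)) \<longlongrightarrow> 0) at_top"
    by (rule poly_times_exp_minus_tendsto_0)
  then have "((\<lambda>h. poly (pCons 0 P) (inverse h) * exp (- inverse h)) \<longlongrightarrow> 0) (at_right 0)"
    by (rule filterlim_compose[OF _ filterlim_inverse_at_top_right])
  then have R: "((\<lambda>h. exp_bump P h / h) \<longlongrightarrow> 0) (at_right 0)"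
    by (rule Lim_transform_eventually)
      (auto simp: exp_bump_def field_simps eventually_at_filter)
  have L: "((\<lambda>h. exp_bump P h / h) \<longlongrightarrow> 0) (at_left 0)"
    by (rule Lim_transform_eventually[of "\<lambda>_. 0"])
      (auto simp: exp_bump_def field_simps eventually_at_filter)
  have "((\<lambda>h. exp_bump P h / h) \<longlongrightarrow> 0) (at 0)"
    using L R by (rule filterlim_split_at)
  then show ?thesis
    using True by (simp add: DERIV_def exp_bump_def)
qed

text \<open>The affine argument keeps the induction closed: a partial derivative is a constant times
  a function of the same shape with another polynomial.\<close>

lemma Ck_on_exp_bump: "Ck_on k UNIV (\<lambda>x. exp_bump P (c + x \<bullet> v))"
proof (induction k arbitrary: P)
  case 0
  have "continuous_on UNIV (exp_bump P)"
    using exp_bump_deriv by (intro DERIV_continuous_on) (auto intro: DERIV_subset)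
  then show ?case
    by (auto intro!: continuous_on_compose2[of UNIV "exp_bump P"] continuous_intros)
next
  case (Suc k)
  let ?Q = "[:0, 0, 1:] * (P - pderiv P)"
  have der: "((\<lambda>x. exp_bump P (c + x \<bullet> v)) has_derivative (\<lambda>b. (b \<bullet> v) * exp_bump ?Q (c + x \<bullet> v))) (at x)" for x
  proof -
    have "((\<lambda>x. c + x \<bullet> v) has_derivative (\<lambda>b. b \<bullet> v)) (at x)"
      by (auto intro!: derivative_eq_intros)
    from has_derivative_compose[OF this exp_bump_deriv[of P, THEN has_field_derivative_imp_has_derivative]]
    show ?thesis by (simp add: mult.commute)
  qed
  show ?case
    by (rule Ck_on_Suc_I[OF der]) (intro Ck_on_mult Ck_on_const Suc.IH)
qed

text \<open>As exp (- 1 / (n t)) tends to 1 for t > 0, the scaling by \<open>n\<close> turns one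
  profile into a sequence that converges pointwise to the indicator of the open box; a cutoff with a
  plateau is avoided.\<close>

definition box_bump :: "'a::euclidean_space \<Rightarrow> 'a \<Rightarrow> nat \<Rightarrow> 'a \<Rightarrow> real" where
  "box_bump a b n x =
     (\<Prod>i\<in>Basis. exp_bump 1 (real n * (x \<bullet> i - a \<bullet> i)) * exp_bump 1 (real n * (b \<bullet> i - x \<bullet> i)))"

lemma Ck_on_box_bump: "Ck_on k UNIV (box_bump a b n)"
proof -
  have "Ck_on k UNIV (\<lambda>x. exp_bump 1 (- real n * (a \<bullet> i) + x \<bullet> (real n *\<^sub>R i)) *
          exp_bump 1 (real n * (b \<bullet> i) + x \<bullet> (- real n *\<^sub>R i)))" for i
    by (intro Ck_on_mult Ck_on_exp_bump)
  then have "Ck_on k UNIV (\<lambda>x. \<Prod>i\<in>Basis. exp_bump 1 (- real n * (a \<bullet> i) + x \<bullet> (real n *\<^sub>R i)) *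
          exp_bump 1 (real n * (b \<bullet> i) + x \<bullet> (- real n *\<^sub>R i)))"
    by (intro Ck_on_prod)
  also have "(\<lambda>x. \<Prod>i\<in>Basis. exp_bump 1 (- real n * (a \<bullet> i) + x \<bullet> (real n *\<^sub>R i)) *
          exp_bump 1 (real n * (b \<bullet> i) + x \<bullet> (- real n *\<^sub>R i))) = box_bump a b n"
    unfolding box_bump_def by (intro ext prod.cong arg_cong2[where f="(*)"] arg_cong[where f="exp_bump 1"])
      (simp_all add: algebra_simps)
  finally show ?thesis .
qed

lemma exp_bump_1_bounds: "0 \<le> exp_bump 1 t" "exp_bump 1 t \<le> 1"
  by (auto simp: exp_bump_def)

lemma box_bump_bounds: "0 \<le> box_bump a b n x" "box_bump a b n x \<le> 1"
  unfolding box_bump_def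
  by (auto intro!: prod_nonneg prod_le_1 mult_le_one mult_nonneg_nonneg exp_bump_1_bounds)

lemma box_bump_outside: "x \<notin> box a b \<Longrightarrow> box_bump a b n x = 0"
  by (force simp: box_bump_def mem_box exp_bump_def zero_less_mult_iff not_less)

lemma box_bump_tendsto: "(\<lambda>n. box_bump a b n x) \<longlonglongrightarrow> indicator (box a b) x"
proof (cases "x \<in> box a b")
  case True
  have *: "(\<lambda>n. exp_bump 1 (real n * t)) \<longlonglongrightarrow> 1" if "t > 0" for t
  proof -
    have "(\<lambda>n. exp (- (1 / t) * (1 / real n))) \<longlonglongrightarrow> exp (- (1/t) * 0)"
      by (intro tendsto_intros lim_1_over_n)
    then have "(\<lambda>n. exp (- (1 / t) * (1 / real n))) \<longlonglongrightarrow> 1" by simp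
    then show ?thesis
      by (rule Lim_transform_eventually)
        (use that in \<open>auto simp: exp_bump_def field_simps intro!: eventually_mono[OF eventually_gt_at_top[of 0]]\<close>)
  qed
  have "(\<lambda>n. box_bump a b n x) \<longlonglongrightarrow> (\<Prod>i\<in>(Basis::'a set). 1 * 1)"
    unfolding box_bump_def
    using True by (intro tendsto_intros *) (auto simp: mem_box)
  with True show ?thesis by simp
qed (simp add: box_bump_outside)

lemma box_bump_test_function:
  assumes "cbox a b \<subseteq> \<Omega>"
  shows "box_bump a b n \<in> test_functions \<Omega>"
proof -
  have "closure {x. box_bump a b n x \<noteq> 0} \<subseteq> cbox a b"
    by (rule closure_minimal) (use box_bump_outside box_subset_cbox in \<open>blast+\<close>)
  moreover from this have "compact (closure {x. box_bump a b n x \<noteq> 0})"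
    by (meson bounded_cbox bounded_subset closed_closure compact_eq_bounded_closed)
  ultimately show ?thesis
    using assms by (auto simp: test_functions_def Ck_on_box_bump)
qed

section \<open>The fundamental lemma of the calculus of variations\<close>

text \<open>Open boxes form an intersection-stable generator of the Borel sets, and the sets over
  which \<open>f\<close> integrates to 0 form a Dynkin system. The whole space belongs to it because
  \<open>f\<close> vanishes off a single box; the complement step depends on this.\<close>

lemma integral_boxes_zero_imp_AE_zero:
  fixes f :: "'a::euclidean_space \<Rightarrow> real"
  assumes f: "integrable lborel f"
    and out: "\<And>x. x \<notin> box a b \<Longrightarrow> f x = 0"
    and 0: "\<And>c d. (LINT x|lborel. indicator (box c d) x * f x) = 0"
  shows "AE x in lborel. f x = 0"
proof (rule sigma_finite_measure.density_zero[OF sigma_finite_lborel f])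
  let ?E = "range (\<lambda>(a, b). box a b::'a set)"
  fix A :: "'a set" assume "A \<in> sets lborel"
  then have A: "A \<in> sigma_sets UNIV ?E" by (simp add: borel_eq_box)
  have "Int_stable ?E"
    by (auto simp: Int_stable_def box_Int_box)
  moreover have "?E \<subseteq> Pow UNIV" by simp
  ultimately show "(LINT x:A|lborel. f x) = 0"
    using A
  proof (induction rule: sigma_sets_induct_disjoint[consumes 3])
    case (basic A) then show ?case using 0 by (auto simp: set_lebesgue_integral_def)
  next
    case empty show ?case by (simp add: set_lebesgue_integral_def)
  next
    case (compl A)
    then have A: "A \<in> sets borel" by (simp add: borel_eq_box)
    have "(LINT x|lborel. f x) = (LINT x|lborel. indicator (box a b) x * f x)"
      using out by (intro Bochner_Integration.integral_cong) (auto simp: indicator_def)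
    then have T: "(LINT x|lborel. f x) = 0" using 0 by simp
    have "(LINT x:UNIV - A|lborel. f x) = (LINT x|lborel. f x - indicator A x *\<^sub>R f x)"
      unfolding set_lebesgue_integral_def
      by (intro Bochner_Integration.integral_cong) (auto simp: indicator_def)
    also have "\<dots> = 0"
      using T compl.IH f integrable_mult_indicator[OF _ f, of A] A
      by (subst Bochner_Integration.integral_diff) (auto simp: set_lebesgue_integral_def)
    finally show ?case .
  next
    case (union A)
    then have A: "A i \<in> sets borel" for i by (auto simp: borel_eq_box)
    have "(LINT x:(\<Union>i. A i)|lborel. f x) = (\<Sum>i. (LINT x:A i|lborel. f x))"
      using union(1) A integrable_mult_indicator[OF _ f, of "\<Union>i. A i"]
      by (intro lebesgue_integral_countable_add) (auto simp: disjoint_family_on_def set_integrable_def)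
    with union show ?case by simp
  qed
qed

text \<open>The Dynkin argument runs over Borel sets, while locally integrable functions are only
  Lebesgue measurable; a Borel representative links the two.\<close>

lemma integrable_lborel_representative:
  fixes f :: "'a::euclidean_space \<Rightarrow> real"
  assumes "integrable lebesgue f"
  obtains g where "integrable lborel g" "AE x in lborel. f x = g x"
    "integral\<^sup>L lebesgue f = integral\<^sup>L lborel g"
proof -
  have m: "f \<in> borel_measurable (completion lborel)" using assms by auto
  obtain g where g: "g \<in> borel_measurable lborel" "AE x in lborel. f x = g x"
    using completion_ex_borel_measurable_real[OF m] by auto
  have ae: "AE x in lebesgue. f x = g x" using g(2) by (rule AE_completion)
  have gl: "g \<in> borel_measurable lebesgue" using g(1) by (rule measurable_completion)
  have "integrable lebesgue g" using assms gl ae integrable_cong_AE[OF m gl ae] by simp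
  then have "integrable lborel g" using integrable_completion[OF g(1)] by simp
  moreover have "integral\<^sup>L lebesgue f = integral\<^sup>L lborel g"
    using integral_cong_AE[OF m gl ae] integral_completion[OF g(1)] by simp
  ultimately show ?thesis using that g by blast
qed

text \<open>Bumps that converge to the indicator of a box with closed box inside
  \<open>\<Omega>\<close> give a vanishing integral over it by dominated convergence. Countably many
  closed boxes exhaust \<open>\<Omega>\<close>, so the exceptional null sets can be united.\<close>

lemma test_functions_integral_zero_imp_AE_zero:
  fixes f :: "'a::euclidean_space \<Rightarrow> real"
  assumes "open \<Omega>" and f: "locally_integrable_on f \<Omega>"
    and 0: "\<And>\<phi>. \<phi> \<in> test_functions \<Omega> \<Longrightarrow> (LINT x|lebesgue_on \<Omega>. f x * \<phi> x) = 0"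
  shows "AE x in lebesgue_on \<Omega>. f x = 0"
proof -
  have \<Omega>: "\<Omega> \<in> sets lebesgue" using \<open>open \<Omega>\<close> by simp
  have box0: "(LINT x|lebesgue. indicator (box a b) x * f x) = 0" if ab: "cbox a b \<subseteq> \<Omega>" for a b
  proof -
    have I: "integrable lebesgue (\<lambda>x. indicator (cbox a b) x * f x)"
      using f ab by (auto simp: locally_integrable_on_def set_integrable_def)
    have "(\<lambda>n. LINT x|lebesgue. box_bump a b n x * (indicator (cbox a b) x * f x))
            \<longlonglongrightarrow> (LINT x|lebesgue. indicator (box a b) x * (indicator (cbox a b) x * f x))"
    proof (rule integral_dominated_convergence[where w="\<lambda>x. norm (indicator (cbox a b) x * f x)"])
      have "box_bump a b n \<in> borel_measurable borel" for n
        using Ck_on_box_bump[of 0 a b n] by (auto intro: borel_measurable_continuous_onI)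
      then have m: "box_bump a b n \<in> borel_measurable lebesgue" for n
        by (auto intro: measurable_completion)
      show "(\<lambda>x. box_bump a b n x * (indicator (cbox a b) x * f x)) \<in> borel_measurable lebesgue" for n
        using m[of n] I by auto
      show "(\<lambda>x. indicator (box a b) x * (indicator (cbox a b) x * f x)) \<in> borel_measurable lebesgue"
        by (intro borel_measurable_times[OF _ borel_measurable_integrable[OF I]] borel_measurable_indicator) auto
      show "integrable lebesgue (\<lambda>x. norm (indicator (cbox a b) x * f x))" using I by auto
      show "AE x in lebesgue. (\<lambda>n. box_bump a b n x * (indicator (cbox a b) x * f x))
              \<longlonglongrightarrow> indicator (box a b) x * (indicator (cbox a b) x * f x)"
        by (intro AE_I2 tendsto_mult box_bump_tendsto tendsto_const)
      show "AE x in lebesgue. norm (box_bump a b n x * (indicator (cbox a b) x * f x))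
               \<le> norm (indicator (cbox a b) x * f x)" for n
        using box_bump_bounds[of a b n]
        by (intro AE_I2) (auto simp: abs_mult intro!: mult_left_le_one_le)
    qed
    moreover have "(LINT x|lebesgue. box_bump a b n x * (indicator (cbox a b) x * f x)) = 0" for n
    proof -
      have "(LINT x|lebesgue. box_bump a b n x * (indicator (cbox a b) x * f x))
         = (LINT x|lebesgue. indicator \<Omega> x *\<^sub>R (f x * box_bump a b n x))"
        using ab box_bump_outside[of _ a b n] box_subset_cbox[of a b]
        by (intro Bochner_Integration.integral_cong) (auto simp: indicator_def)
      also have "\<dots> = (LINT x|lebesgue_on \<Omega>. f x * box_bump a b n x)"
        using \<Omega> by (subst integral_restrict_space) auto
      also have "\<dots> = 0" by (rule 0[OF box_bump_test_function[OF ab]])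
      finally show ?thesis .
    qed
    ultimately have "(LINT x|lebesgue. indicator (box a b) x * (indicator (cbox a b) x * f x)) = 0"
      by (simp add: LIMSEQ_const_iff)
    moreover have "indicator (box a b) x * (indicator (cbox a b) x * f x) = indicator (box a b) x * f x" for x
      using box_subset_cbox[of a b] by (auto simp: indicator_def)
    ultimately show ?thesis by simp
  qed
  have AEbox: "AE x in lborel. x \<in> cbox a b \<longrightarrow> f x = 0" if ab: "cbox a b \<subseteq> \<Omega>" for a b
  proof -
    have "integrable lebesgue (\<lambda>x. indicator (cbox a b) x * f x)"
      using f ab by (auto simp: locally_integrable_on_def set_integrable_def)
    then have "integrable lebesgue (\<lambda>x. indicator (box a b) x *\<^sub>R (indicator (cbox a b) x * f x))"
      by (intro integrable_mult_indicator) auto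
    moreover have "(\<lambda>x. indicator (box a b) x *\<^sub>R (indicator (cbox a b) x * f x)) = (\<lambda>x. indicator (box a b) x * f x)"
      using box_subset_cbox[of a b] by (intro ext) (auto simp: indicator_def)
    ultimately have I: "integrable lebesgue (\<lambda>x. indicator (box a b) x * f x)" by metis
    obtain g where g: "integrable lborel g" "AE x in lborel. indicator (box a b) x * f x = g x"
      using integrable_lborel_representative[OF I] by blast
    \<comment> \<open>\<open>g\<close> agrees with the truncated function only almost everywhere;
      cutting it off again makes it vanish at every point outside the box.\<close>
    define h where "h x = indicator (box a b) x * g x" for x
    have h: "integrable lborel h"
      using integrable_mult_indicator[OF _ g(1), of "box a b"] by (simp add: h_def[abs_def])
    have ae: "AE x in lborel. indicator (box a b) x * f x = h x"
      using g(2) by eventually_elim (auto simp: h_def indicator_def)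
    have "AE x in lborel. h x = 0"
    proof (rule integral_boxes_zero_imp_AE_zero[OF h])
      show "h x = 0" if "x \<notin> box a b" for x using that by (simp add: h_def)
      fix c d :: 'a
      obtain c' d' where c': "box c d \<inter> box a b = box c' d'"
        using box_Int_box by blast
      have "(LINT x|lborel. indicator (box c d) x * h x) = (LINT x|lebesgue. indicator (box c d) x * h x)"
        using h by (intro integral_completion[symmetric]) auto
      also have "\<dots> = (LINT x|lebesgue. indicator (box c d) x * (indicator (box a b) x * f x))"
      proof (rule integral_cong_AE)
        show "(\<lambda>x. indicator (box c d) x * h x) \<in> borel_measurable lebesgue"
          using h by (intro measurable_completion) auto
        show "(\<lambda>x. indicator (box c d) x * (indicator (box a b) x * f x)) \<in> borel_measurable lebesgue"
          by (intro borel_measurable_times[OF _ borel_measurable_integrable[OF I]] borel_measurable_indicator) auto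
        show "AE x in lebesgue. indicator (box c d) x * h x = indicator (box c d) x * (indicator (box a b) x * f x)"
          using AE_completion[OF ae] by eventually_elim simp
      qed
      also have "\<dots> = (LINT x|lebesgue. indicator (box c' d') x * f x)"
        using c' by (intro Bochner_Integration.integral_cong) (auto simp: indicator_def)
      also have "\<dots> = 0"
      \<comment> \<open>A nonempty open box has the closed box as its closure, which then stays in
        \<open>cbox a b\<close>. An empty one leaves its corners unconstrained, so its closed box
        could leave \<open>\<Omega>\<close>, but its integral is 0 anyway.\<close>
      proof (cases "box c' d' = {}")
        case False
        then have "cbox c' d' \<subseteq> cbox a b"
          using c' closure_mono[of "box c' d'" "box a b"]
          by (cases "box a b = {}") (auto simp: closure_box)
        then show ?thesis using box0 ab by blast
      qed simp
      finally show "(LINT x|lborel. indicator (box c d) x * h x) = 0" .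
    qed
    \<comment> \<open>Passing from the open to the closed box costs only the faces, a null
      set.\<close>
    moreover have "AE x in lborel. x \<notin> cbox a b - box a b"
      by (rule AE_not_in) (auto simp: null_sets_def emeasure_lborel_cbox_eq emeasure_lborel_box_eq emeasure_Diff box_subset_cbox)
    ultimately show ?thesis using ae
      by eventually_elim (auto simp: indicator_def split: if_splits)
  qed
  obtain D where D: "countable D" "D \<subseteq> Pow \<Omega>" "\<And>X. X \<in> D \<Longrightarrow> \<exists>a b. X = cbox a b" "\<Union>D = \<Omega>"
    using open_countable_Union_open_cbox[OF \<open>open \<Omega>\<close>] by metis
  have "AE x in lborel. x \<in> X \<longrightarrow> f x = 0" if X: "X \<in> D" for X
  proof -
    obtain a b where "X = cbox a b" using D(3)[OF X] by blast
    with AEbox[of a b] D(2) X show ?thesis by blast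
  qed
  then have "AE x in lborel. \<forall>X\<in>D. x \<in> X \<longrightarrow> f x = 0"
    unfolding AE_ball_countable[OF D(1)] by blast
  then have "AE x in lborel. x \<in> \<Omega> \<longrightarrow> f x = 0"
    by eventually_elim (use D in auto)
  then show ?thesis
    using \<Omega> by (auto simp: AE_restrict_space_iff intro: AE_completion)
qed

section \<open>Lebesgue spaces and pointwise inequalities\<close>

lemma Lp_spaceD:
  assumes "f \<in> Lp_space \<Omega> q"
  shows "f \<in> borel_measurable (lebesgue_on \<Omega>)"
    and "integrable (lebesgue_on \<Omega>) (\<lambda>x. norm (f x) powr q)"
  using assms by (auto simp: Lp_space_def)

lemma Lp_norm_nonneg: "0 \<le> Lp_norm \<Omega> q f"
  by (simp add: Lp_norm_def)

lemma Lp_norm_powr: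
  assumes "q > 0"
  shows "Lp_norm \<Omega> q f powr q = (LINT x|lebesgue_on \<Omega>. norm (f x) powr q)"
proof -
  have "0 \<le> (LINT x|lebesgue_on \<Omega>. norm (f x) powr q)"
    by (intro Bochner_Integration.integral_nonneg) auto
  with assms show ?thesis by (simp add: Lp_norm_def powr_powr)
qed

lemma Lp_norm_2_square: "(Lp_norm \<Omega> 2 f)\<^sup>2 = (LINT x|lebesgue_on \<Omega>. (norm (f x))\<^sup>2)"
  using Lp_norm_powr[of 2 \<Omega> f] Lp_norm_nonneg[of \<Omega> 2 f] by simp

lemma Lp_2_integrable_square:
  "f \<in> Lp_space \<Omega> 2 \<Longrightarrow> integrable (lebesgue_on \<Omega>) (\<lambda>x. (norm (f x))\<^sup>2)"
  using Lp_spaceD(2)[of f \<Omega> 2] by simp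

lemma Holder_conjugate_gt_1:
  fixes q q' :: real
  assumes "q > 1" "1 / q + 1 / q' = 1"
  shows "q' > 1"
proof -
  have "1 / q < 1" "1 / q > 0" using assms(1) by auto
  then have "1 / q' > 0" "1 / q' < 1" using assms(2) by linarith+
  then show ?thesis by (simp add: divide_less_eq split: if_splits)
qed

text \<open>Young's inequality gives integrability directly. For the bound it is applied to f / F
  and g / G with F and G the norms, so a vanishing norm is treated apart; there the product is 0
  almost everywhere.\<close>

lemma Lp_Holder:
  fixes f :: "'a::euclidean_space \<Rightarrow> 'b::euclidean_space" and g :: "'a \<Rightarrow> 'c::euclidean_space"
  assumes f: "f \<in> Lp_space \<Omega> q" and g: "g \<in> Lp_space \<Omega> q'"
    and q: "q > 1" "1 / q + 1 / q' = 1"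
  shows "integrable (lebesgue_on \<Omega>) (\<lambda>x. norm (f x) * norm (g x))"
    and "(LINT x|lebesgue_on \<Omega>. norm (f x) * norm (g x)) \<le> Lp_norm \<Omega> q f * Lp_norm \<Omega> q' g"
proof -
  note q' = Holder_conjugate_gt_1[OF q]
  note fm = Lp_spaceD[OF f] and gm = Lp_spaceD[OF g]
  have Y: "norm (f x) * norm (g x) \<le> norm (f x) powr q / q + norm (g x) powr q' / q'" for x
    using Youngs_inequality[of q q'] q q' by simp
  show I: "integrable (lebesgue_on \<Omega>) (\<lambda>x. norm (f x) * norm (g x))"
  proof (rule Bochner_Integration.integrable_bound)
    show "integrable (lebesgue_on \<Omega>) (\<lambda>x. norm (f x) powr q / q + norm (g x) powr q' / q')"
      using fm gm by auto
    show "(\<lambda>x. norm (f x) * norm (g x)) \<in> borel_measurable (lebesgue_on \<Omega>)"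
      using fm(1) gm(1) by measurable
    show "AE x in lebesgue_on \<Omega>. norm (norm (f x) * norm (g x))
            \<le> norm (norm (f x) powr q / q + norm (g x) powr q' / q')"
      using Y by (intro AE_I2) (metis abs_ge_self abs_mult abs_norm_cancel order_trans real_norm_def)
  qed
  show "(LINT x|lebesgue_on \<Omega>. norm (f x) * norm (g x)) \<le> Lp_norm \<Omega> q f * Lp_norm \<Omega> q' g"
  proof (cases "Lp_norm \<Omega> q f = 0 \<or> Lp_norm \<Omega> q' g = 0")
    case True
    have *: "AE x in lebesgue_on \<Omega>. h x = 0" if "h \<in> Lp_space \<Omega> s" "Lp_norm \<Omega> s h = 0" "s > 1"
      for s and h :: "'a \<Rightarrow> 'd::euclidean_space"
    proof -
      have "(LINT x|lebesgue_on \<Omega>. norm (h x) powr s) = 0"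
        using that Lp_norm_powr[of s \<Omega> h] by simp
      then have "AE x in lebesgue_on \<Omega>. norm (h x) powr s = 0"
        using integral_nonneg_eq_0_iff_AE[OF Lp_spaceD(2)[OF that(1)]] by simp
      then show ?thesis by eventually_elim simp
    qed
    have "AE x in lebesgue_on \<Omega>. norm (f x) * norm (g x) = 0"
      using True *[OF f _ q(1)] *[OF g _ q'] by auto
    then have "(LINT x|lebesgue_on \<Omega>. norm (f x) * norm (g x)) = 0"
      by (rule integral_eq_zero_AE)
    with True show ?thesis by auto
  next
    case False
    define F G where "F = Lp_norm \<Omega> q f" and "G = Lp_norm \<Omega> q' g"
    have FG: "F > 0" "G > 0" using False Lp_norm_nonneg[of \<Omega>] by (auto simp: F_def G_def less_le)
    have Fp: "(LINT x|lebesgue_on \<Omega>. norm (f x) powr q) = F powr q"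
      and Gp: "(LINT x|lebesgue_on \<Omega>. norm (g x) powr q') = G powr q'"
      using Lp_norm_powr[of q \<Omega> f] Lp_norm_powr[of q' \<Omega> g] q q' by (auto simp: F_def G_def)
    have "norm (f x) * norm (g x) \<le> F * G *
        (norm (f x) powr q / (q * F powr q) + norm (g x) powr q' / (q' * G powr q'))" for x
    proof -
      have "norm (f x) / F * (norm (g x) / G) \<le>
          (norm (f x) / F) powr q / q + (norm (g x) / G) powr q' / q'"
        using FG q q' by (intro Youngs_inequality) auto
      also have "\<dots> = norm (f x) powr q / (q * F powr q) + norm (g x) powr q' / (q' * G powr q')"
        using FG by (simp add: powr_divide mult.commute)
      finally show ?thesis using FG by (simp add: field_simps)
    qed
    then have "(LINT x|lebesgue_on \<Omega>. norm (f x) * norm (g x)) \<le>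
        (LINT x|lebesgue_on \<Omega>. F * G *
        (norm (f x) powr q / (q * F powr q) + norm (g x) powr q' / (q' * G powr q')))"
      using fm gm I by (intro integral_mono) auto
    also have "\<dots> = F * G * (F powr q / (q * F powr q) + G powr q' / (q' * G powr q'))"
      using fm gm by (simp add: Fp Gp)
    also have "\<dots> = F * G * (1 / q + 1 / q')" using FG by simp
    finally show ?thesis using q by (simp add: F_def G_def)
  qed
qed

text \<open>Meant for integrands such as \<open>(G x *v z x) \<bullet> v x\<close>, which are
  dominated by a product of two norms without being a product of two functions.\<close>

lemma Lp_Holder_dominated:
  fixes f :: "'a::euclidean_space \<Rightarrow> 'b::euclidean_space" and g :: "'a \<Rightarrow> 'c::euclidean_space"
    and k :: "'a \<Rightarrow> real"
  assumes f: "f \<in> Lp_space \<Omega> q" and g: "g \<in> Lp_space \<Omega> q'"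
    and q: "q > 1" "1 / q + 1 / q' = 1"
    and k: "k \<in> borel_measurable (lebesgue_on \<Omega>)" "\<And>x. \<bar>k x\<bar> \<le> norm (f x) * norm (g x)"
  shows "integrable (lebesgue_on \<Omega>) k"
    and "\<bar>LINT x|lebesgue_on \<Omega>. k x\<bar> \<le> Lp_norm \<Omega> q f * Lp_norm \<Omega> q' g"
proof -
  note H = Lp_Holder[OF f g q]
  show I: "integrable (lebesgue_on \<Omega>) k"
    using H(1) k(1) by (rule Bochner_Integration.integrable_bound) (use k(2) in auto)
  have "\<bar>LINT x|lebesgue_on \<Omega>. k x\<bar> \<le> (LINT x|lebesgue_on \<Omega>. norm (f x) * norm (g x))"
    using integral_norm_bound[of "lebesgue_on \<Omega>" k] integral_mono[OF integrable_norm[OF I] H(1)] k(2)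
    by (smt (verit) real_norm_def)
  with H(2) show "\<bar>LINT x|lebesgue_on \<Omega>. k x\<bar> \<le> Lp_norm \<Omega> q f * Lp_norm \<Omega> q' g" by linarith
qed

lemma Lp_inner:
  fixes f g :: "'a::euclidean_space \<Rightarrow> 'b::euclidean_space"
  assumes f: "f \<in> Lp_space \<Omega> q" and g: "g \<in> Lp_space \<Omega> q'" and q: "q > 1" "1 / q + 1 / q' = 1"
  shows "integrable (lebesgue_on \<Omega>) (\<lambda>x. f x \<bullet> g x)"
    and "\<bar>LINT x|lebesgue_on \<Omega>. f x \<bullet> g x\<bar> \<le> Lp_norm \<Omega> q f * Lp_norm \<Omega> q' g"
  using Lp_Holder_dominated[OF f g q, of "\<lambda>x. f x \<bullet> g x"] Lp_spaceD(1)[OF f] Lp_spaceD(1)[OF g]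
    Cauchy_Schwarz_ineq2 by auto

text \<open>Comparison with twice the maximum. The convexity constant \<open>2 powr (q - 1)\<close>
  would fail for q < 1, an exponent that occurs in the weight of A when p < 4.\<close>

lemma powr_sum_le:
  fixes a b q :: real
  assumes "a \<ge> 0" "b \<ge> 0" "q \<ge> 0"
  shows "(a + b) powr q \<le> 2 powr q * (a powr q + b powr q)"
proof -
  have "(a + b) powr q \<le> (2 * max a b) powr q"
    using assms by (intro powr_mono2) auto
  also have "\<dots> = 2 powr q * (max a b) powr q"
    using assms by (simp add: powr_mult)
  also have "\<dots> \<le> 2 powr q * (a powr q + b powr q)"
    by (intro mult_left_mono) (auto simp: max_def)
  finally show ?thesis .
qed

lemma Lp_space_dominated:
  fixes f :: "'a::euclidean_space \<Rightarrow> 'b::euclidean_space"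
  assumes "f \<in> borel_measurable (lebesgue_on \<Omega>)" "integrable (lebesgue_on \<Omega>) w"
    "\<And>x. norm (f x) powr q \<le> w x"
  shows "f \<in> Lp_space \<Omega> q"
  unfolding Lp_space_def
proof (safe intro!: assms(1))
  show "integrable (lebesgue_on \<Omega>) (\<lambda>x. norm (f x) powr q)"
    using assms(2)
  proof (rule Bochner_Integration.integrable_bound)
    show "(\<lambda>x. norm (f x) powr q) \<in> borel_measurable (lebesgue_on \<Omega>)"
      using assms(1) by measurable
    show "AE x in lebesgue_on \<Omega>. norm (norm (f x) powr q) \<le> norm (w x)"
      using assms(3) by (intro AE_I2) (smt (verit) norm_ge_zero real_norm_def powr_ge_zero)
  qed
qed

lemma Lp_space_lincomb:
  fixes f g :: "'a::euclidean_space \<Rightarrow> 'b::euclidean_space"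
  assumes f: "f \<in> Lp_space \<Omega> q" and g: "g \<in> Lp_space \<Omega> q" and q: "q \<ge> 0"
  shows "(\<lambda>x. a *\<^sub>R f x + b *\<^sub>R g x) \<in> Lp_space \<Omega> q"
proof (rule Lp_space_dominated)
  show "(\<lambda>x. a *\<^sub>R f x + b *\<^sub>R g x) \<in> borel_measurable (lebesgue_on \<Omega>)"
    using Lp_spaceD(1)[OF f] Lp_spaceD(1)[OF g] by measurable
  show "integrable (lebesgue_on \<Omega>)
      (\<lambda>x. 2 powr q * (\<bar>a\<bar> powr q * norm (f x) powr q + \<bar>b\<bar> powr q * norm (g x) powr q))"
    using Lp_spaceD(2)[OF f] Lp_spaceD(2)[OF g] by auto
  fix x
  have "norm (a *\<^sub>R f x + b *\<^sub>R g x) powr q \<le> (\<bar>a\<bar> * norm (f x) + \<bar>b\<bar> * norm (g x)) powr q"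
    using q norm_triangle_ineq[of "a *\<^sub>R f x" "b *\<^sub>R g x"] by (intro powr_mono2) auto
  also have "\<dots> \<le> 2 powr q * ((\<bar>a\<bar> * norm (f x)) powr q + (\<bar>b\<bar> * norm (g x)) powr q)"
    using q by (intro powr_sum_le) auto
  finally show "norm (a *\<^sub>R f x + b *\<^sub>R g x) powr q \<le>
      2 powr q * (\<bar>a\<bar> powr q * norm (f x) powr q + \<bar>b\<bar> powr q * norm (g x) powr q)"
    by (simp add: powr_mult)
qed

lemma Lp_space_diff:
  fixes f g :: "'a::euclidean_space \<Rightarrow> 'b::euclidean_space"
  assumes "f \<in> Lp_space \<Omega> q" "g \<in> Lp_space \<Omega> q" "q \<ge> 0"
  shows "(\<lambda>x. f x - g x) \<in> Lp_space \<Omega> q"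
  using Lp_space_lincomb[OF assms, of 1 "-1"] by simp

text \<open>The power with exponent \<open>q\<close> dominates where |f| <= 1, the one with exponent
  \<open>r\<close> elsewhere.\<close>

lemma Lp_space_interpolation:
  fixes f :: "'a::euclidean_space \<Rightarrow> 'b::euclidean_space"
  assumes f: "f \<in> Lp_space \<Omega> q" "f \<in> Lp_space \<Omega> r" and s: "q \<le> s" "s \<le> r"
  shows "f \<in> Lp_space \<Omega> s"
proof (rule Lp_space_dominated)
  show "f \<in> borel_measurable (lebesgue_on \<Omega>)" using f by (auto dest: Lp_spaceD)
  show "integrable (lebesgue_on \<Omega>) (\<lambda>x. norm (f x) powr q + norm (f x) powr r)"
    using Lp_spaceD(2)[OF f(1)] Lp_spaceD(2)[OF f(2)] by auto
  fix x
  show "norm (f x) powr s \<le> norm (f x) powr q + norm (f x) powr r"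
  proof (cases "norm (f x) \<le> 1")
    case True
    then have "norm (f x) powr s \<le> norm (f x) powr q" using s by (intro powr_mono') auto
    then show ?thesis by (smt (verit) powr_ge_zero)
  next
    case False
    then have "norm (f x) powr s \<le> norm (f x) powr r" using s by (intro powr_mono) auto
    then show ?thesis by (smt (verit) powr_ge_zero)
  qed
qed

lemma Lp_space_powr:
  fixes f :: "'a::euclidean_space \<Rightarrow> 'b::euclidean_space"
  assumes "f \<in> Lp_space \<Omega> q" and "s * t = q"
  shows "(\<lambda>x. norm (f x) powr s) \<in> Lp_space \<Omega> t"
  using assms Lp_spaceD[OF assms(1)] by (auto simp: Lp_space_def powr_powr)

text \<open>Young's inequality for |f|^t and |g|^t with the conjugate exponents q/t and s/t.\<close>

lemma Lp_space_product:
  fixes f :: "'a::euclidean_space \<Rightarrow> 'b::euclidean_space" and g :: "'a \<Rightarrow> 'c::euclidean_space"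
    and k :: "'a \<Rightarrow> 'd::euclidean_space"
  assumes f: "f \<in> Lp_space \<Omega> q" and g: "g \<in> Lp_space \<Omega> s"
    and e: "1 / q + 1 / s = 1 / t" "q > 0" "s > 0" "t > 0"
    and k: "k \<in> borel_measurable (lebesgue_on \<Omega>)" "\<And>x. norm (k x) \<le> norm (f x) * norm (g x)"
  shows "k \<in> Lp_space \<Omega> t"
proof (rule Lp_space_dominated)
  have "t / q + t / s = t * (1 / q + 1 / s)" by (simp add: distrib_left)
  then have e': "t / q + t / s = 1" using e by simp
  have "t / q > 0" "t / s > 0" using e by auto
  then have lt: "t / q < 1" "t / s < 1" using e' by linarith+
  have "q / t > 1" "s / t > 1" using lt e by (auto simp: field_simps)
  show "k \<in> borel_measurable (lebesgue_on \<Omega>)" by fact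
  show "integrable (lebesgue_on \<Omega>) (\<lambda>x. norm (f x) powr q / (q / t) + norm (g x) powr s / (s / t))"
    using Lp_spaceD(2)[OF f] Lp_spaceD(2)[OF g] by auto
  fix x
  have "norm (k x) powr t \<le> (norm (f x) * norm (g x)) powr t"
    using k(2) e by (intro powr_mono2) auto
  also have "\<dots> = norm (f x) powr t * norm (g x) powr t"
    by (simp add: powr_mult)
  also have "\<dots> \<le> (norm (f x) powr t) powr (q / t) / (q / t) + (norm (g x) powr t) powr (s / t) / (s / t)"
    using \<open>q / t > 1\<close> \<open>s / t > 1\<close> e' by (intro Youngs_inequality) auto
  finally show "norm (k x) powr t \<le> norm (f x) powr q / (q / t) + norm (g x) powr s / (s / t)"
    using e by (simp add: powr_powr)
qed

section \<open>Matrix norms and pointwise inequalities for the nonlinearities\<close>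

lemma norm_matrix_vector_mult_le:
  fixes A :: "real^'n^'m"
  shows "norm (A *v x) \<le> norm A * norm x"
proof -
  have "(norm (A *v x))\<^sup>2 = (\<Sum>i\<in>UNIV. (A $ i \<bullet> x)\<^sup>2)"
    by (simp add: norm_vec_def L2_set_def real_sqrt_pow2 sum_nonneg matrix_vector_mul_component)
  also have "\<dots> \<le> (\<Sum>i\<in>UNIV. (norm (A $ i))\<^sup>2 * (norm x)\<^sup>2)"
    by (intro sum_mono) (metis Cauchy_Schwarz_ineq power2_norm_eq_inner)
  also have "\<dots> = (norm A * norm x)\<^sup>2"
    by (simp add: norm_vec_def[of A] L2_set_def real_sqrt_pow2 sum_nonneg sum_distrib_right power_mult_distrib)
  finally show ?thesis
    by (rule power2_le_imp_le) simp
qed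

text \<open>By transposition, the square of the left side is the inner product of \<open>x\<close>
  with \<open>A\<close> applied to \<open>x v* A\<close>; after Cauchy-Schwarz one factor
  cancels.\<close>

lemma norm_vector_matrix_mult_le:
  fixes A :: "real^'n^'m"
  shows "norm (x v* A) \<le> norm x * norm A"
proof -
  have "(norm (x v* A))\<^sup>2 = x \<bullet> (A *v (x v* A))"
    by (simp add: power2_norm_eq_inner dot_lmul_matrix)
  also have "\<dots> \<le> norm x * (norm A * norm (x v* A))"
    by (meson Cauchy_Schwarz_ineq2 abs_le_D1 mult_left_mono norm_ge_zero norm_matrix_vector_mult_le order_trans)
  finally have "norm (x v* A) * norm (x v* A) \<le> (norm x * norm A) * norm (x v* A)"
    by (simp add: power2_eq_square mult_ac)
  then show ?thesis
    by (metis mult_le_cancel_right mult_nonneg_nonneg norm_ge_zero not_le order.trans)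
qed

text \<open>Splitting the weights into half sum and half difference gives an identity: the pairing
  equals (a + b)/2 |x - y|^2 + (a - b)(|x|^2 - |y|^2)/2. Weights that increase with the norm make
  the last term nonnegative.\<close>

lemma weighted_difference_ge:
  fixes x y :: "'a::real_inner"
  assumes "(a - b) * ((norm x)\<^sup>2 - (norm y)\<^sup>2) \<ge> 0"
  shows "(a *\<^sub>R x - b *\<^sub>R y) \<bullet> (x - y) \<ge> (a + b) / 2 * (norm (x - y))\<^sup>2"
proof -
  have "(a *\<^sub>R x - b *\<^sub>R y) \<bullet> (x - y) =
      (a + b) / 2 * (norm (x - y))\<^sup>2 + (a - b) * ((norm x)\<^sup>2 - (norm y)\<^sup>2) / 2"
    unfolding power2_norm_eq_inner by (simp add: inner_simps inner_commute algebra_simps field_simps)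
  with assms show ?thesis by simp
qed

lemma mono_diff_mult_nonneg:
  fixes f :: "real \<Rightarrow> real"
  assumes "\<And>s t. 0 \<le> s \<Longrightarrow> s \<le> t \<Longrightarrow> f s \<le> f t" "0 \<le> s" "0 \<le> t"
  shows "(f s - f t) * (s\<^sup>2 - t\<^sup>2) \<ge> 0"
proof (cases "s \<le> t")
  case True
  then show ?thesis using assms by (intro mult_nonpos_nonpos) (auto simp: power_mono)
next
  case False
  then show ?thesis using assms by (intro mult_nonneg_nonneg) (auto simp: power_mono)
qed

lemma A_pointwise_monotone:
  fixes x y :: "'a::real_inner"
  assumes "p \<ge> 2"
  shows "((1 + (norm x)\<^sup>2) powr ((p - 2) / 2) *\<^sub>R x - (1 + (norm y)\<^sup>2) powr ((p - 2) / 2) *\<^sub>R y) \<bullet> (x - y)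
           \<ge> (norm (x - y))\<^sup>2"
proof -
  let ?w = "\<lambda>t::real. (1 + t\<^sup>2) powr ((p - 2) / 2)"
  have "(?w (norm x) *\<^sub>R x - ?w (norm y) *\<^sub>R y) \<bullet> (x - y)
      \<ge> (?w (norm x) + ?w (norm y)) / 2 * (norm (x - y))\<^sup>2"
    by (intro weighted_difference_ge mono_diff_mult_nonneg)
      (use assms in \<open>auto intro!: powr_mono2 power_mono\<close>)
  moreover have "?w t \<ge> 1" for t using assms by (intro ge_one_powr_ge_zero) auto
  from this[of "norm x"] this[of "norm y"] have "1 \<le> (?w (norm x) + ?w (norm y)) / 2" by simp
  then have "1 * (norm (x - y))\<^sup>2 \<le> (?w (norm x) + ?w (norm y)) / 2 * (norm (x - y))\<^sup>2"
    by (rule mult_right_mono) simp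
  ultimately show ?thesis by linarith
qed

text \<open>Of the averaged weight only the half with |y| is kept, because the convective remainder
  to be absorbed carries |y| and not |x|.\<close>

lemma C_pointwise_monotone:
  fixes x y :: "'a::real_inner"
  assumes "r \<ge> 2"
  shows "(norm x powr (r - 2) *\<^sub>R x - norm y powr (r - 2) *\<^sub>R y) \<bullet> (x - y)
           \<ge> 1 / 2 * norm y powr (r - 2) * (norm (x - y))\<^sup>2"
proof -
  let ?w = "\<lambda>t::real. t powr (r - 2)"
  have "(?w (norm x) *\<^sub>R x - ?w (norm y) *\<^sub>R y) \<bullet> (x - y)
      \<ge> (?w (norm x) + ?w (norm y)) / 2 * (norm (x - y))\<^sup>2"
    by (intro weighted_difference_ge mono_diff_mult_nonneg)
      (use assms in \<open>auto intro!: powr_mono2\<close>)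
  moreover have "?w (norm y) / 2 * (norm (x - y))\<^sup>2 \<le> (?w (norm x) + ?w (norm y)) / 2 * (norm (x - y))\<^sup>2"
    by (intro mult_right_mono) auto
  ultimately show ?thesis by simp
qed

text \<open>The additive constant is the maximum over t of t^2/(2 \<mu>) - (\<beta>/2) t^(r-2),
  attained at t^2 = \<open>s\<close>. The proof therefore bounds t^2/(2 \<mu>) and passes to t^2/(4
  \<mu>) at the end.\<close>

lemma square_le_powr_plus_eta:
  fixes t r \<mu> \<beta> :: real
  assumes "r > 4" "\<mu> > 0" "\<beta> > 0" "t \<ge> 0"
  shows "t\<^sup>2 / (4 * \<mu>) \<le> \<beta> / 2 * t powr (r - 2)
           + (r - 4) / (2 * \<mu> * (r - 2)) * (2 / (\<beta> * \<mu> * (r - 2))) powr (2 / (r - 4))"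
proof -
  define s where "s = (2 / (\<beta> * \<mu> * (r - 2))) powr (2 / (r - 4))"
  define m where "m = (r - 2) / 2"
  \<comment> \<open>Rescaling by the maximiser reduces the claim to z <= z^m / m + (m - 1)/m, which
    is Young's inequality for z and 1, with equality at z = 1.\<close>
  define z where "z = t\<^sup>2 / s"
  have s: "s > 0" using assms by (simp add: s_def)
  have m: "m > 1" using assms by (simp add: m_def)
  have "s powr (m - 1) = (2 / (\<beta> * \<mu> * (r - 2))) powr (2 / (r - 4) * ((r - 4) / 2))"
    by (simp add: s_def m_def powr_powr diff_divide_distrib)
  also have "2 / (r - 4) * ((r - 4) / 2) = 1" using assms by simp
  also have "(2 / (\<beta> * \<mu> * (r - 2))) powr 1 = 2 / (\<beta> * \<mu> * (r - 2))" using assms by simp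
  finally have sm: "s powr (m - 1) = 2 / (\<beta> * \<mu> * (r - 2))" .
  have z: "z \<ge> 0" using s by (simp add: z_def)
  have ts: "t\<^sup>2 = z * s" using s by (simp add: z_def)
  have "t powr (r - 2) = (t\<^sup>2) powr m"
    using assms powr_powr[of t 2 m] by (simp add: m_def diff_divide_distrib)
  also have "\<dots> = z powr m * (s powr (m - 1) * s)"
    using z s powr_add[of s "m - 1" 1] by (simp add: ts powr_mult)
  finally have tr: "\<beta> / 2 * t powr (r - 2) = s / (\<mu> * (r - 2)) * z powr m"
    using assms by (simp add: sm field_simps)
  have "z * 1 \<le> z powr m / m + 1 powr (m / (m - 1)) / (m / (m - 1))"
    using m z by (intro Youngs_inequality) (auto simp: field_simps)
  then have "z \<le> z powr m / m + (m - 1) / m" by simp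
  also have "(m - 1) / m = (r - 4) / (r - 2)" using assms by (simp add: m_def field_simps)
  also have "z powr m / m = 2 / (r - 2) * z powr m" by (simp add: m_def)
  finally have "s / (2 * \<mu>) * z \<le> s / (2 * \<mu>) * (2 / (r - 2) * z powr m + (r - 4) / (r - 2))"
    using s assms by (intro mult_left_mono) auto
  also have "\<dots> = \<beta> / 2 * t powr (r - 2) + (r - 4) / (2 * \<mu> * (r - 2)) * s"
    unfolding tr by (simp add: distrib_left mult_ac)
  finally have "s / (2 * \<mu>) * z \<le> \<beta> / 2 * t powr (r - 2) + (r - 4) / (2 * \<mu> * (r - 2)) * s" .
  moreover have "t\<^sup>2 / (4 * \<mu>) \<le> s / (2 * \<mu>) * z" using assms z s mult_nonneg_nonneg[of s z] by (simp add: ts field_simps)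
  ultimately show ?thesis by (simp add: s_def)
qed

section \<open>Test functions and weak gradients\<close>

lemma test_functionE:
  fixes \<phi> :: "'a::euclidean_space \<Rightarrow> 'b::real_normed_vector"
  assumes "\<phi> \<in> test_functions \<Omega>"
  obtains K where "compact K" "K \<subseteq> \<Omega>" "\<And>x. x \<notin> K \<Longrightarrow> \<phi> x = 0"
proof
  show "compact (closure {x. \<phi> x \<noteq> 0})" "closure {x. \<phi> x \<noteq> 0} \<subseteq> \<Omega>"
    using assms by (simp_all add: test_functions_def)
  show "\<phi> x = 0" if "x \<notin> closure {x. \<phi> x \<noteq> 0}" for x
    using that closure_subset[of "{x. \<phi> x \<noteq> 0}"] by blast
qed

lemma test_function_Ck: "\<phi> \<in> test_functions \<Omega> \<Longrightarrow> Ck_on k UNIV \<phi>"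
  unfolding test_functions_def by blast

lemma test_function_has_derivative:
  "\<phi> \<in> test_functions \<Omega> \<Longrightarrow> (\<phi> has_derivative frechet_derivative \<phi> (at x)) (at x)"
  by (rule Ck_on_Suc_E(1)[OF test_function_Ck])

lemma test_function_continuous:
  assumes "\<phi> \<in> test_functions \<Omega>"
  shows "continuous_on S \<phi>"
proof -
  have "continuous_on UNIV \<phi>" using test_function_Ck[OF assms, of 0] by simp
  then show ?thesis by (rule continuous_on_subset) simp
qed

lemma test_function_derivative_continuous:
  assumes "\<phi> \<in> test_functions \<Omega>" "b \<in> Basis"
  shows "continuous_on S (\<lambda>x. frechet_derivative \<phi> (at x) b)"
proof -
  have "continuous_on UNIV (\<lambda>x. frechet_derivative \<phi> (at x) b)"
    using Ck_on_Suc_E(2)[OF test_function_Ck[OF assms(1)] assms(2), of 0] by simp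
  then show ?thesis by (rule continuous_on_subset) simp
qed

lemma derivative_outside_support:
  fixes f :: "'a::euclidean_space \<Rightarrow> 'b::real_normed_vector"
  assumes "compact K" "\<And>x. x \<notin> K \<Longrightarrow> f x = 0" "x \<notin> K" "(f has_derivative f') (at x)"
  shows "f' = (\<lambda>_. 0)"
proof -
  have "open (- K)" using assms(1) by (simp add: compact_imp_closed open_Compl)
  then have "((\<lambda>_. 0) has_derivative f') (at x)"
    using assms(2,3) by (intro has_derivative_transform_within_open[OF assms(4)]) auto
  then show ?thesis
    by (rule has_derivative_unique) (rule has_derivative_const)
qed

lemma test_function_derivative_outside:
  assumes "\<phi> \<in> test_functions \<Omega>" "compact K" "\<And>x. x \<notin> K \<Longrightarrow> \<phi> x = 0" "x \<notin> K"
  shows "frechet_derivative \<phi> (at x) b = 0"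
  using derivative_outside_support[OF assms(2-4) test_function_has_derivative[OF assms(1)]] by simp

lemma test_function_mult:
  fixes f g :: "'a::euclidean_space \<Rightarrow> real"
  assumes "f \<in> test_functions \<Omega>" "\<And>k. Ck_on k UNIV g"
  shows "(\<lambda>x. f x * g x) \<in> test_functions \<Omega>"
proof -
  have sub: "closure {x. f x * g x \<noteq> 0} \<subseteq> closure {x. f x \<noteq> 0}"
    by (intro closure_mono) auto
  then have "compact (closure {x. f x * g x \<noteq> 0})"
    using assms(1) by (auto simp: test_functions_def compact_eq_bounded_closed bounded_subset)
  with sub assms show ?thesis
    by (auto simp: test_functions_def intro!: Ck_on_mult simp del: Ck_on.simps)
qed

lemma test_function_component:
  fixes \<phi> :: "'a::euclidean_space \<Rightarrow> real^'n"
  assumes "\<phi> \<in> test_functions \<Omega>"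
  shows "(\<lambda>x. \<phi> x $ i) \<in> test_functions \<Omega>"
proof -
  have sub: "closure {x. \<phi> x $ i \<noteq> 0} \<subseteq> closure {x. \<phi> x \<noteq> 0}"
    by (intro closure_mono) auto
  then have "compact (closure {x. \<phi> x $ i \<noteq> 0})"
    using assms(1) by (auto simp: test_functions_def compact_eq_bounded_closed bounded_subset)
  with sub assms show ?thesis
    by (auto simp: test_functions_def intro!: Ck_on_bounded_linear[OF bounded_linear_vec_nth] simp del: Ck_on.simps)
qed

section \<open>Integrals of derivatives over the whole space\<close>

lemma integral_translation_lborel:
  fixes f :: "'a::euclidean_space \<Rightarrow> real"
  assumes "f \<in> borel_measurable borel"
  shows "(LINT x|lborel. f (c + x)) = (LINT x|lborel. f x)"
proof -
  have "(LINT x|lborel. f x) = (LINT x|distr lborel borel ((+) c). f x)"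
    by (simp add: lborel_distr_plus)
  also have "\<dots> = (LINT x|lborel. f (c + x))"
    using assms by (intro integral_distr) auto
  finally show ?thesis by simp
qed

lemma integrable_translation_lborel:
  fixes f :: "'a::euclidean_space \<Rightarrow> real"
  assumes "integrable lborel f"
  shows "integrable lborel (\<lambda>x. f (c + x))"
proof -
  have "integrable (distr lborel borel ((+) c)) f"
    using assms by (simp add: lborel_distr_plus)
  then show ?thesis
    using assms by (subst (asm) integrable_distr_eq) auto
qed

text \<open>The integral is the limit of the integrals of difference quotients, which vanish because
  Lebesgue measure is translation invariant.\<close>

lemma integral_directional_derivative_zero:
  fixes f :: "'a::euclidean_space \<Rightarrow> real"
  assumes der: "\<And>x. (f has_derivative f' x) (at x)"
    and cont: "continuous_on UNIV (\<lambda>x. f' x e)"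
    and K: "compact K" "\<And>x. x \<notin> K \<Longrightarrow> f x = 0"
  shows "(LINT x|lborel. f' x e) = 0"
proof -
  have f_cont: "continuous_on UNIV f"
    using der by (intro has_derivative_continuous_on) (auto intro: has_derivative_at_withinI)
  then have fm: "f \<in> borel_measurable borel" by (rule borel_measurable_continuous_onI)
  have gm: "(\<lambda>x. f' x e) \<in> borel_measurable borel" using cont by (rule borel_measurable_continuous_onI)
  have out: "f' x e = 0" if "x \<notin> K" for x
    using derivative_outside_support[OF K that der] by simp
  obtain M where M: "\<And>x. \<bar>f' x e\<bar> \<le> M"
  proof -
    have "bounded ((\<lambda>x. f' x e) ` K)"
      using cont K(1) by (intro compact_imp_bounded compact_continuous_image) (auto intro: continuous_on_subset)
    then obtain B where B: "\<And>x. x \<in> K \<Longrightarrow> \<bar>f' x e\<bar> \<le> B"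
      by (auto simp: bounded_iff)
    have "\<bar>f' x e\<bar> \<le> max B 0" for x
      using B[of x] out[of x] by (cases "x \<in> K") auto
    then show ?thesis using that by blast
  qed
  obtain R where R: "\<And>x. x \<in> K \<Longrightarrow> norm x \<le> R"
    using compact_imp_bounded[OF K(1)] by (auto simp: bounded_iff)
  \<comment> \<open>\<open>R\<close> bounds the support and the steps \<open>h n\<close> are at most
    1, so every difference quotient vanishes outside this ball; inside it the mean value theorem
    bounds the quotient by \<open>M\<close>.\<close>
  define B where "B = cball (0::'a) (R + norm e)"
  define h where "h n = inverse (real (Suc n))" for n
  have h: "h n > 0" "h n \<le> 1" for n by (auto simp: h_def inverse_le_1_iff)
  have line: "((\<lambda>t. f (t *\<^sub>R e + x)) has_real_derivative f' (t *\<^sub>R e + x) e) (at t)" for x t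
  proof -
    have "((\<lambda>t. t *\<^sub>R e + x) has_derivative (\<lambda>s. s *\<^sub>R e)) (at t)"
      by (auto intro!: derivative_eq_intros)
    from has_derivative_compose[OF this der]
    have "((\<lambda>t. f (t *\<^sub>R e + x)) has_derivative (\<lambda>s. f' (t *\<^sub>R e + x) (s *\<^sub>R e))) (at t)" .
    moreover have "f' (t *\<^sub>R e + x) (s *\<^sub>R e) = f' (t *\<^sub>R e + x) e * s" for s
      using linear_cmul[OF has_derivative_linear[OF der]] by simp
    ultimately show ?thesis by (simp add: has_field_derivative_def)
  qed
  define q where "q n x = (f (h n *\<^sub>R e + x) - f x) / h n" for n x
  have fi: "integrable lborel f"
  proof -
    have "integrable lborel (\<lambda>x. indicator K x *\<^sub>R f x)"
      using K(1) continuous_on_subset[OF f_cont] by (intro borel_integrable_compact) auto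
    also have "(\<lambda>x. indicator K x *\<^sub>R f x) = f"
      using K(2) by (intro ext) (auto simp: indicator_def)
    finally show ?thesis .
  qed
  have q0: "(LINT x|lborel. q n x) = 0" for n
    using fi fm integrable_translation_lborel[OF fi] integral_translation_lborel[OF fm]
    by (simp add: q_def)
  have "(\<lambda>n. LINT x|lborel. q n x) \<longlonglongrightarrow> (LINT x|lborel. f' x e)"
  proof (rule integral_dominated_convergence[where w="\<lambda>x. M * indicator B x"])
    show "(\<lambda>x. f' x e) \<in> borel_measurable lborel" using gm by simp
    show "q n \<in> borel_measurable lborel" for n
      using fm unfolding q_def by measurable
    show "integrable lborel (\<lambda>x. M * indicator B x)"
      using emeasure_lborel_cball_finite by (intro integrable_mult_right integrable_real_indicator) (auto simp: B_def)
    have "(\<lambda>n. q n x) \<longlonglongrightarrow> f' x e" for x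
    proof -
      have "filterlim h (at 0) sequentially"
        using LIMSEQ_inverse_real_of_nat h(1) unfolding h_def[abs_def]
        by (intro filterlim_atI) (auto simp del: of_nat_Suc)
      moreover have "((\<lambda>s. (f (s *\<^sub>R e + x) - f x) / s) \<longlongrightarrow> f' x e) (at 0)"
        using line[of x 0] by (simp add: DERIV_def)
      ultimately show ?thesis
        unfolding q_def by (rule filterlim_compose[rotated])
    qed
    then show "AE x in lborel. (\<lambda>n. q n x) \<longlonglongrightarrow> f' x e" by simp
    have "\<bar>q n x\<bar> \<le> M * indicator B x" for n x
    proof (cases "x \<in> B")
      case True
      obtain z where "f (h n *\<^sub>R e + x) - f (0 *\<^sub>R e + x) = (h n - 0) * f' (z *\<^sub>R e + x) e"
        using MVT2[of 0 "h n" "\<lambda>t. f (t *\<^sub>R e + x)" "\<lambda>t. f' (t *\<^sub>R e + x) e", OF h(1) line] by blast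
      then have "q n x = f' (z *\<^sub>R e + x) e" using h(1)[of n] by (simp add: q_def)
      with M True show ?thesis by simp
    next
      case False
      then have x: "norm x > R + norm e" by (simp add: B_def)
      then have "x \<notin> K" using R[of x] norm_ge_zero[of e] by linarith
      have "norm (h n *\<^sub>R e) \<le> norm e" using h[of n] by (simp add: mult_left_le_one_le)
      then have "norm (h n *\<^sub>R e + x) > R"
        using x norm_triangle_ineq4[of "h n *\<^sub>R e + x" "h n *\<^sub>R e"] by simp
      then have "h n *\<^sub>R e + x \<notin> K" using R by force
      with \<open>x \<notin> K\<close> K(2) False show ?thesis by (simp add: q_def)
    qed
    then show "AE x in lborel. norm (q n x) \<le> M * indicator B x" for n by simp
  qed
  then show ?thesis by (simp add: q0 LIMSEQ_const_iff)
qed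

lemma integral_lebesgue_on_eq_lborel:
  fixes f :: "'a::euclidean_space \<Rightarrow> real"
  assumes "\<Omega> \<in> sets lebesgue" "f \<in> borel_measurable borel" "\<And>x. x \<notin> \<Omega> \<Longrightarrow> f x = 0"
  shows "(LINT x|lebesgue_on \<Omega>. f x) = (LINT x|lborel. f x)"
proof -
  have "(LINT x|lebesgue_on \<Omega>. f x) = (LINT x|lebesgue. indicator \<Omega> x *\<^sub>R f x)"
    using assms(1) by (subst integral_restrict_space) auto
  also have "\<dots> = (LINT x|lebesgue. f x)"
    using assms(3) by (intro Bochner_Integration.integral_cong) (auto simp: indicator_def)
  also have "\<dots> = (LINT x|lborel. f x)"
    using assms(2) by (intro integral_completion) auto
  finally show ?thesis .
qed

section \<open>Local integrability\<close>

lemma locally_integrable_scaleR_continuous: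
  fixes f :: "'a::euclidean_space \<Rightarrow> 'b::euclidean_space" and g :: "'a \<Rightarrow> real"
  assumes \<Omega>: "\<Omega> \<in> sets lebesgue" and f: "locally_integrable_on f \<Omega>" and g: "continuous_on UNIV g"
    and K: "compact K" "K \<subseteq> \<Omega>" "\<And>x. x \<notin> K \<Longrightarrow> g x = 0"
  shows "integrable (lebesgue_on \<Omega>) (\<lambda>x. g x *\<^sub>R f x)"
proof -
  have I: "integrable lebesgue (\<lambda>x. indicator K x *\<^sub>R f x)"
    using f K by (auto simp: locally_integrable_on_def set_integrable_def)
  have gm: "g \<in> borel_measurable lebesgue"
    using borel_measurable_continuous_onI[OF g] by (intro measurable_completion) simp
  obtain c where c: "\<And>x. x \<in> K \<Longrightarrow> \<bar>g x\<bar> \<le> c"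
    using compact_imp_bounded[OF compact_continuous_image[OF continuous_on_subset[OF g] K(1)]]
    by (auto simp: bounded_iff)
  have "integrable lebesgue (\<lambda>x. g x *\<^sub>R (indicator K x *\<^sub>R f x))"
  proof (rule Bochner_Integration.integrable_bound)
    show "integrable lebesgue (\<lambda>x. c *\<^sub>R (indicator K x *\<^sub>R f x))"
      using I by (rule integrable_scaleR_right)
    show "(\<lambda>x. g x *\<^sub>R (indicator K x *\<^sub>R f x)) \<in> borel_measurable lebesgue"
      using gm borel_measurable_integrable[OF I] by (rule borel_measurable_scaleR)
    show "AE x in lebesgue. norm (g x *\<^sub>R (indicator K x *\<^sub>R f x)) \<le> norm (c *\<^sub>R (indicator K x *\<^sub>R f x))"
      using c by (intro AE_I2) (fastforce simp: indicator_def intro: mult_right_mono)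
  qed
  also have "(\<lambda>x. g x *\<^sub>R (indicator K x *\<^sub>R f x)) = (\<lambda>x. indicator \<Omega> x *\<^sub>R (g x *\<^sub>R f x))"
    using K by (intro ext) (auto simp: indicator_def)
  finally show ?thesis using \<Omega> by (subst integrable_restrict_space) auto
qed

lemma locally_integrable_bounded_linear:
  fixes f :: "'a::euclidean_space \<Rightarrow> 'b::euclidean_space" and L :: "'b \<Rightarrow> 'c::euclidean_space"
  assumes "bounded_linear L" "locally_integrable_on f \<Omega>"
  shows "locally_integrable_on (\<lambda>x. L (f x)) \<Omega>"
  unfolding locally_integrable_on_def
proof safe
  fix K assume "compact K" "K \<subseteq> \<Omega>"
  then have "integrable lebesgue (\<lambda>x. indicator K x *\<^sub>R f x)"
    using assms(2) by (auto simp: locally_integrable_on_def set_integrable_def)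
  from integrable_bounded_linear[OF assms(1) this]
  show "(\<lambda>x. L (f x)) absolutely_integrable_on K"
    by (simp add: set_integrable_def linear_cmul[OF bounded_linear.linear[OF assms(1)]])
qed

lemma locally_integrable_lincomb:
  assumes "locally_integrable_on f \<Omega>" "locally_integrable_on g \<Omega>"
  shows "locally_integrable_on (\<lambda>x. a *\<^sub>R f x + b *\<^sub>R g x) \<Omega>"
  unfolding locally_integrable_on_def
proof safe
  fix K assume "compact K" "K \<subseteq> \<Omega>"
  then have "set_integrable lebesgue K f" "set_integrable lebesgue K g"
    using assms by (auto simp: locally_integrable_on_def)
  then show "(\<lambda>x. a *\<^sub>R f x + b *\<^sub>R g x) absolutely_integrable_on K"
    by (intro set_integral_add(1) set_integrable_scaleR_right) auto
qed

lemma locally_integrable_continuous: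
  fixes f :: "'a::euclidean_space \<Rightarrow> 'b::euclidean_space"
  shows "continuous_on UNIV f \<Longrightarrow> locally_integrable_on f \<Omega>"
  unfolding locally_integrable_on_def
proof safe
  fix K :: "'a set" assume "continuous_on UNIV f" "compact K"
  then have "integrable lborel (\<lambda>x. indicator K x *\<^sub>R f x)"
    by (intro borel_integrable_compact) (auto intro: continuous_on_subset)
  then show "f absolutely_integrable_on K"
    unfolding set_integrable_def by (subst integrable_completion) auto
qed

section \<open>Classical gradients of test functions\<close>

definition classical_grad :: "(real^'d \<Rightarrow> real^'d) \<Rightarrow> real^'d \<Rightarrow> real^'d^'d" where
  "classical_grad \<phi> x = (\<chi> i j. frechet_derivative \<phi> (at x) (axis j 1) $ i)"

lemma classical_grad_nth [simp]:
  "classical_grad \<phi> x $ i $ j = frechet_derivative \<phi> (at x) (axis j 1) $ i"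
  by (simp add: classical_grad_def)

lemma axis_1_Basis: "axis j (1::real) \<in> Basis"
  by (simp add: axis_in_Basis_iff)

lemma classical_grad_continuous:
  assumes "\<phi> \<in> test_functions \<Omega>"
  shows "continuous_on S (classical_grad \<phi>)"
  unfolding classical_grad_def[abs_def]
  using test_function_derivative_continuous[OF assms axis_1_Basis]
  by (intro continuous_on_vec_lambda continuous_on_component)

lemma classical_grad_outside:
  assumes "\<phi> \<in> test_functions \<Omega>" "compact K" "\<And>x. x \<notin> K \<Longrightarrow> \<phi> x = 0" "x \<notin> K"
  shows "classical_grad \<phi> x = 0"
  using test_function_derivative_outside[OF assms] by (simp add: vec_eq_iff)

lemma continuous_compact_support_Lp:
  fixes f :: "'a::euclidean_space \<Rightarrow> 'b::euclidean_space"
  assumes "\<Omega> \<in> sets lebesgue" "continuous_on UNIV f" "compact K" "\<And>x. x \<notin> K \<Longrightarrow> f x = 0" "q > 0"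
  shows "f \<in> Lp_space \<Omega> q"
proof -
  have "f \<in> borel_measurable borel" using assms(2) by (rule borel_measurable_continuous_onI)
  then have fm: "f \<in> borel_measurable lebesgue" by (intro measurable_completion) simp
  have c: "continuous_on UNIV (\<lambda>x. norm (f x) powr q)"
    using assms(2,5) by (intro continuous_on_powr' continuous_intros) auto
  have "integrable lborel (\<lambda>x. indicator K x *\<^sub>R (norm (f x) powr q))"
    using assms(3) continuous_on_subset[OF c] by (intro borel_integrable_compact) auto
  also have "(\<lambda>x. indicator K x *\<^sub>R (norm (f x) powr q)) = (\<lambda>x. norm (f x) powr q)"
    using assms(4) by (intro ext) (auto simp: indicator_def)
  finally have "integrable lebesgue (\<lambda>x. norm (f x) powr q)"
    by (subst integrable_completion) auto
  then have "integrable lebesgue (\<lambda>x. indicator \<Omega> x *\<^sub>R (norm (f x) powr q))"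
    using assms(1) by (intro integrable_mult_indicator) auto
  then have "integrable (lebesgue_on \<Omega>) (\<lambda>x. norm (f x) powr q)"
    using assms(1) by (subst integrable_restrict_space) auto
  with fm show ?thesis by (simp add: Lp_space_def measurable_restrict_space1)
qed

lemma test_function_Lp:
  fixes \<phi> :: "'a::euclidean_space \<Rightarrow> 'b::euclidean_space"
  assumes "\<Omega> \<in> sets lebesgue" "\<phi> \<in> test_functions \<Omega>" "q > 0"
  shows "\<phi> \<in> Lp_space \<Omega> q"
proof -
  obtain K where K: "compact K" "\<And>x. x \<notin> K \<Longrightarrow> \<phi> x = 0"
    using test_functionE[OF assms(2)] by metis
  show ?thesis
    using assms(1) test_function_continuous[OF assms(2)] K assms(3)
    by (rule continuous_compact_support_Lp)
qed

lemma classical_grad_Lp: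
  assumes "\<Omega> \<in> sets lebesgue" "\<phi> \<in> test_functions \<Omega>" "q > 0"
  shows "classical_grad \<phi> \<in> Lp_space \<Omega> q"
proof -
  obtain K where K: "compact K" "\<And>x. x \<notin> K \<Longrightarrow> \<phi> x = 0"
    using test_functionE[OF assms(2)] by metis
  show ?thesis
    using assms(1) classical_grad_continuous[OF assms(2)] K(1) classical_grad_outside[OF assms(2) K] assms(3)
    by (rule continuous_compact_support_Lp)
qed

lemma locally_integrable_times_test:
  fixes f :: "'a::euclidean_space \<Rightarrow> real"
  assumes "\<Omega> \<in> sets lebesgue" "locally_integrable_on f \<Omega>" "\<psi> \<in> test_functions \<Omega>"
  shows "integrable (lebesgue_on \<Omega>) (\<lambda>x. f x * \<psi> x)"
    and "b \<in> Basis \<Longrightarrow> integrable (lebesgue_on \<Omega>) (\<lambda>x. f x * frechet_derivative \<psi> (at x) b)"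
proof -
  obtain K where K: "compact K" "K \<subseteq> \<Omega>" "\<And>x. x \<notin> K \<Longrightarrow> \<psi> x = 0"
    using test_functionE[OF assms(3)] by metis
  show "integrable (lebesgue_on \<Omega>) (\<lambda>x. f x * \<psi> x)"
    using locally_integrable_scaleR_continuous[OF assms(1,2) test_function_continuous[OF assms(3)] K]
    by (simp add: mult.commute)
  assume "b \<in> Basis"
  from locally_integrable_scaleR_continuous[OF assms(1,2)
      test_function_derivative_continuous[OF assms(3) this] K(1,2)]
  show "integrable (lebesgue_on \<Omega>) (\<lambda>x. f x * frechet_derivative \<psi> (at x) b)"
    using test_function_derivative_outside[OF assms(3) K(1,3)] by (simp add: mult.commute)
qed

section \<open>Weak gradients: uniqueness and linearity\<close>

lemma has_weak_gradient_onD: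
  assumes "has_weak_gradient_on u G \<Omega>" "\<psi> \<in> test_functions \<Omega>"
  shows "(LINT x|lebesgue_on \<Omega>. u x $ i * frechet_derivative \<psi> (at x) (axis j 1)) =
      - (LINT x|lebesgue_on \<Omega>. G x $ i $ j * \<psi> x)"
  using assms unfolding has_weak_gradient_on_def by blast

lemma weak_gradient_components:
  assumes "has_weak_gradient_on u G \<Omega>"
  shows "locally_integrable_on (\<lambda>x. u x $ i) \<Omega>" "locally_integrable_on (\<lambda>x. G x $ i $ j) \<Omega>"
  using assms
  by (auto simp: has_weak_gradient_on_def
      intro!: locally_integrable_bounded_linear[OF bounded_linear_vec_nth]
        locally_integrable_bounded_linear[OF bounded_linear_compose[OF bounded_linear_vec_nth bounded_linear_vec_nth]])

text \<open>A component of \<open>\<phi>\<close> times \<open>\<psi>\<close> has compact support, so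
  its partial derivative integrates to 0 over the whole space, and the product rule splits that
  integral into the two sides. As \<open>\<psi>\<close> and its derivatives vanish off
  \<open>\<Omega>\<close>, the integral over the domain is the one over the whole space.\<close>

lemma test_function_has_weak_gradient:
  assumes \<Omega>: "\<Omega> \<in> sets lebesgue" and \<phi>: "\<phi> \<in> test_functions \<Omega>"
  shows "has_weak_gradient_on \<phi> (classical_grad \<phi>) \<Omega>"
  unfolding has_weak_gradient_on_def
proof (intro conjI allI impI)
  show l: "locally_integrable_on \<phi> \<Omega>" "locally_integrable_on (classical_grad \<phi>) \<Omega>"
    using test_function_continuous[OF \<phi>] classical_grad_continuous[OF \<phi>]
    by (auto intro: locally_integrable_continuous)
  fix \<psi> :: "real^'a \<Rightarrow> real" and i j
  assume \<psi>: "\<psi> \<in> test_functions \<Omega>"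
  let ?e = "axis j (1::real) :: real^'a"
  obtain K where K: "compact K" "K \<subseteq> \<Omega>" "\<And>x. x \<notin> K \<Longrightarrow> \<psi> x = 0"
    using test_functionE[OF \<psi>] by metis
  have d\<psi>: "frechet_derivative \<psi> (at x) b = 0" if "x \<notin> K" for x b
    using test_function_derivative_outside[OF \<psi> K(1,3) that] .
  let ?f' = "\<lambda>x b. \<phi> x $ i * frechet_derivative \<psi> (at x) b + frechet_derivative \<phi> (at x) b $ i * \<psi> x"
  have der: "((\<lambda>x. \<phi> x $ i * \<psi> x) has_derivative ?f' x) (at x)" for x
    by (intro has_derivative_mult bounded_linear.has_derivative[OF bounded_linear_vec_nth]
        test_function_has_derivative[OF \<phi>] test_function_has_derivative[OF \<psi>])
  have cont: "continuous_on UNIV (\<lambda>x. ?f' x ?e)"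
    by (intro continuous_on_add continuous_on_mult continuous_on_component
        test_function_continuous[OF \<phi>] test_function_continuous[OF \<psi>]
        test_function_derivative_continuous[OF \<phi> axis_1_Basis] test_function_derivative_continuous[OF \<psi> axis_1_Basis])
  have "(LINT x|lebesgue_on \<Omega>. ?f' x ?e) = (LINT x|lborel. ?f' x ?e)"
  proof (rule integral_lebesgue_on_eq_lborel[OF \<Omega> borel_measurable_continuous_onI[OF cont]])
    fix x assume "x \<notin> \<Omega>"
    then have "x \<notin> K" using K(2) by blast
    then show "?f' x ?e = 0" by (simp add: d\<psi> K(3))
  qed
  also have "\<dots> = 0"
    using der cont K(1) by (rule integral_directional_derivative_zero) (simp add: K(3))
  finally have "(LINT x|lebesgue_on \<Omega>. ?f' x ?e) = 0" .
  moreover have "integrable (lebesgue_on \<Omega>) (\<lambda>x. \<phi> x $ i * frechet_derivative \<psi> (at x) ?e)"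
    by (intro locally_integrable_times_test(2)[OF \<Omega> _ \<psi> axis_1_Basis]
        locally_integrable_bounded_linear[OF bounded_linear_vec_nth l(1)])
  moreover have "integrable (lebesgue_on \<Omega>) (\<lambda>x. frechet_derivative \<phi> (at x) ?e $ i * \<psi> x)"
    using locally_integrable_times_test(1)[OF \<Omega> _ \<psi>,
        OF locally_integrable_bounded_linear[OF bounded_linear_compose[OF bounded_linear_vec_nth bounded_linear_vec_nth] l(2)], of i j]
    by simp
  ultimately show "(LINT x|lebesgue_on \<Omega>. \<phi> x $ i * frechet_derivative \<psi> (at x) ?e) =
      - (LINT x|lebesgue_on \<Omega>. classical_grad \<phi> x $ i $ j * \<psi> x)"
    by simp
qed

text \<open>Entry by entry, the difference of two weak gradients integrates to 0 against all test
  functions, so the fundamental lemma applies.\<close>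

lemma weak_gradient_unique:
  assumes "open \<Omega>" and G: "has_weak_gradient_on u G \<Omega>" and H: "has_weak_gradient_on u H \<Omega>"
  shows "AE x in lebesgue_on \<Omega>. G x = H x"
proof -
  have \<Omega>: "\<Omega> \<in> sets lebesgue" using \<open>open \<Omega>\<close> by simp
  have "AE x in lebesgue_on \<Omega>. G x $ i $ j - H x $ i $ j = 0" for i j
  proof (rule test_functions_integral_zero_imp_AE_zero[OF \<open>open \<Omega>\<close>])
    show "locally_integrable_on (\<lambda>x. G x $ i $ j - H x $ i $ j) \<Omega>"
      using locally_integrable_lincomb[OF weak_gradient_components(2)[OF G] weak_gradient_components(2)[OF H], of 1 i j "-1" i j]
      by simp
    fix \<psi> :: "real^'a \<Rightarrow> real" assume \<psi>: "\<psi> \<in> test_functions \<Omega>"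
    have "(LINT x|lebesgue_on \<Omega>. G x $ i $ j * \<psi> x) = (LINT x|lebesgue_on \<Omega>. H x $ i $ j * \<psi> x)"
    proof -
      have "- (LINT x|lebesgue_on \<Omega>. G x $ i $ j * \<psi> x) = - (LINT x|lebesgue_on \<Omega>. H x $ i $ j * \<psi> x)"
        using has_weak_gradient_onD[OF G \<psi>, of i j] has_weak_gradient_onD[OF H \<psi>, of i j] by (rule trans[OF sym])
      then show ?thesis by simp
    qed
    then show "(LINT x|lebesgue_on \<Omega>. (G x $ i $ j - H x $ i $ j) * \<psi> x) = 0"
      using locally_integrable_times_test(1)[OF \<Omega> weak_gradient_components(2)[OF G] \<psi>, of i j]
        locally_integrable_times_test(1)[OF \<Omega> weak_gradient_components(2)[OF H] \<psi>, of i j]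
      by (simp add: left_diff_distrib)
  qed
  then have "AE x in lebesgue_on \<Omega>. \<forall>i j. G x $ i $ j - H x $ i $ j = 0"
    by (simp add: AE_all_countable)
  then show ?thesis
    by eventually_elim (simp add: vec_eq_iff)
qed

lemma weak_gradient_lincomb:
  assumes \<Omega>: "\<Omega> \<in> sets lebesgue" and G: "has_weak_gradient_on u G \<Omega>" and H: "has_weak_gradient_on v H \<Omega>"
  shows "has_weak_gradient_on (\<lambda>x. a *\<^sub>R u x + b *\<^sub>R v x) (\<lambda>x. a *\<^sub>R G x + b *\<^sub>R H x) \<Omega>"
  unfolding has_weak_gradient_on_def
proof (intro conjI allI impI)
  show "locally_integrable_on (\<lambda>x. a *\<^sub>R u x + b *\<^sub>R v x) \<Omega>"
    "locally_integrable_on (\<lambda>x. a *\<^sub>R G x + b *\<^sub>R H x) \<Omega>"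
    using G H by (auto simp: has_weak_gradient_on_def intro: locally_integrable_lincomb)
  fix \<psi> :: "real^'a \<Rightarrow> real" and i j
  assume \<psi>: "\<psi> \<in> test_functions \<Omega>"
  note I = locally_integrable_times_test(1)[OF \<Omega> weak_gradient_components(2)[OF G] \<psi>, of i j]
    locally_integrable_times_test(1)[OF \<Omega> weak_gradient_components(2)[OF H] \<psi>, of i j]
    locally_integrable_times_test(2)[OF \<Omega> weak_gradient_components(1)[OF G] \<psi> axis_1_Basis, of i j]
    locally_integrable_times_test(2)[OF \<Omega> weak_gradient_components(1)[OF H] \<psi> axis_1_Basis, of i j]
  have e: "(LINT x|lebesgue_on \<Omega>. u x $ i * frechet_derivative \<psi> (at x) (axis j 1)) =
      - (LINT x|lebesgue_on \<Omega>. G x $ i $ j * \<psi> x)"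
    "(LINT x|lebesgue_on \<Omega>. v x $ i * frechet_derivative \<psi> (at x) (axis j 1)) =
      - (LINT x|lebesgue_on \<Omega>. H x $ i $ j * \<psi> x)"
    using has_weak_gradient_onD[OF G \<psi>] has_weak_gradient_onD[OF H \<psi>] by blast+
  have "(LINT x|lebesgue_on \<Omega>. (a *\<^sub>R u x + b *\<^sub>R v x) $ i * frechet_derivative \<psi> (at x) (axis j 1)) =
      (LINT x|lebesgue_on \<Omega>. a * (u x $ i * frechet_derivative \<psi> (at x) (axis j 1))
        + b * (v x $ i * frechet_derivative \<psi> (at x) (axis j 1)))"
    by (simp add: distrib_right mult.assoc)
  also have "\<dots> = - (a * (LINT x|lebesgue_on \<Omega>. G x $ i $ j * \<psi> x) + b * (LINT x|lebesgue_on \<Omega>. H x $ i $ j * \<psi> x))"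
    using I e by simp
  also have "\<dots> = - (LINT x|lebesgue_on \<Omega>. a * (G x $ i $ j * \<psi> x) + b * (H x $ i $ j * \<psi> x))"
    using I by simp
  also have "\<dots> = - (LINT x|lebesgue_on \<Omega>. (a *\<^sub>R G x + b *\<^sub>R H x) $ i $ j * \<psi> x)"
    by (simp add: distrib_right mult.assoc)
  finally show "(LINT x|lebesgue_on \<Omega>. (a *\<^sub>R u x + b *\<^sub>R v x) $ i * frechet_derivative \<psi> (at x) (axis j 1)) =
      - (LINT x|lebesgue_on \<Omega>. (a *\<^sub>R G x + b *\<^sub>R H x) $ i $ j * \<psi> x)" .
qed

lemma has_weak_gradient_weak_grad:
  "has_weak_gradient_on u G \<Omega> \<Longrightarrow> has_weak_gradient_on u (weak_grad \<Omega> u) \<Omega>"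
  unfolding weak_grad_def by (rule someI[of "\<lambda>G. has_weak_gradient_on u G \<Omega>"])

text \<open>The choice behind \<open>weak_grad\<close> respects linear combinations only up to null
  sets. \<open>G\<close> and \<open>H\<close> are arbitrary weak gradients so that classical
  gradients of test functions can be inserted.\<close>

lemma weak_grad_lincomb:
  assumes "open \<Omega>" "has_weak_gradient_on u G \<Omega>" "has_weak_gradient_on v H \<Omega>"
  shows "AE x in lebesgue_on \<Omega>. weak_grad \<Omega> (\<lambda>x. a *\<^sub>R u x + b *\<^sub>R v x) x = a *\<^sub>R G x + b *\<^sub>R H x"
proof -
  have "has_weak_gradient_on (\<lambda>x. a *\<^sub>R u x + b *\<^sub>R v x) (\<lambda>x. a *\<^sub>R G x + b *\<^sub>R H x) \<Omega>"
    using assms by (intro weak_gradient_lincomb) auto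
  from weak_gradient_unique[OF assms(1) has_weak_gradient_weak_grad[OF this] this] show ?thesis .
qed

lemma weak_grad_diff:
  assumes "open \<Omega>" "has_weak_gradient_on u G \<Omega>" "has_weak_gradient_on v H \<Omega>"
  shows "AE x in lebesgue_on \<Omega>. weak_grad \<Omega> (\<lambda>x. u x - v x) x = G x - H x"
  using weak_grad_lincomb[OF assms, of 1 "-1"] by simp

lemma W1p_spaceD:
  assumes "u \<in> W1p_space \<Omega> q"
  shows "u \<in> Lp_space \<Omega> q" "weak_grad \<Omega> u \<in> Lp_space \<Omega> q" "has_weak_gradient_on u (weak_grad \<Omega> u) \<Omega>"
  using assms by (auto simp: W1p_space_def intro: has_weak_gradient_weak_grad)

text \<open>Completeness of Lebesgue measure. It yields measurability of integrands that contain the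
  chosen gradient of a combination, which is known only almost everywhere.\<close>

lemma borel_measurable_lebesgue_on_AE:
  fixes f g :: "'a::euclidean_space \<Rightarrow> 'b::euclidean_space"
  assumes \<Omega>: "\<Omega> \<in> sets lebesgue" and f: "f \<in> borel_measurable (lebesgue_on \<Omega>)"
    and ae: "AE x in lebesgue_on \<Omega>. f x = g x"
  shows "g \<in> borel_measurable (lebesgue_on \<Omega>)"
proof -
  have "(\<lambda>x. if x \<in> \<Omega> then f x else 0) \<in> borel_measurable lebesgue"
    using f \<Omega> by (simp add: borel_measurable_if)
  moreover have "AE x in lebesgue. x \<in> \<Omega> \<longrightarrow> f x = g x"
    using ae \<Omega> by (simp add: AE_restrict_space_iff)
  then have "AE x in lebesgue. (if x \<in> \<Omega> then f x else 0) = (if x \<in> \<Omega> then g x else 0)"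
    by eventually_elim auto
  ultimately have "(\<lambda>x. if x \<in> \<Omega> then g x else 0) \<in> borel_measurable lebesgue"
    by (rule borel_measurable_AE)
  then show ?thesis using \<Omega> by (simp add: borel_measurable_if)
qed

lemma Lp_norm_AE_cong:
  fixes f g :: "'a::euclidean_space \<Rightarrow> 'b::euclidean_space"
  assumes \<Omega>: "\<Omega> \<in> sets lebesgue" and f: "f \<in> borel_measurable (lebesgue_on \<Omega>)"
    and ae: "AE x in lebesgue_on \<Omega>. f x = g x"
  shows "Lp_norm \<Omega> q f = Lp_norm \<Omega> q g"
proof -
  have g: "g \<in> borel_measurable (lebesgue_on \<Omega>)" by (rule borel_measurable_lebesgue_on_AE[OF assms])
  have "(LINT x|lebesgue_on \<Omega>. norm (f x) powr q) = (LINT x|lebesgue_on \<Omega>. norm (g x) powr q)"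
  proof (rule integral_cong_AE)
    show "(\<lambda>x. norm (f x) powr q) \<in> borel_measurable (lebesgue_on \<Omega>)" using f by measurable
    show "(\<lambda>x. norm (g x) powr q) \<in> borel_measurable (lebesgue_on \<Omega>)" using g by measurable
    show "AE x in lebesgue_on \<Omega>. norm (f x) powr q = norm (g x) powr q"
      using ae by eventually_elim simp
  qed
  then show ?thesis by (simp add: Lp_norm_def)
qed

text \<open>Each part of the Sobolev norm is at most the whole, and the chosen gradient of the
  difference may be exchanged for the explicit one without changing its norm.\<close>

lemma W01p_approx:
  assumes "open \<Omega>" and u: "u \<in> W01p_space \<Omega> q" and q: "q > 0" and e: "\<epsilon> > 0"
  obtains \<phi> where "\<phi> \<in> test_functions \<Omega>" "Lp_norm \<Omega> q (\<lambda>x. u x - \<phi> x) < \<epsilon>"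
    "Lp_norm \<Omega> q (\<lambda>x. weak_grad \<Omega> u x - classical_grad \<phi> x) < \<epsilon>"
proof -
  have \<Omega>: "\<Omega> \<in> sets lebesgue" using \<open>open \<Omega>\<close> by simp
  have uW: "u \<in> W1p_space \<Omega> q" using u by (simp add: W01p_space_def norm_closure_in_def)
  obtain \<phi> where \<phi>: "\<phi> \<in> test_functions \<Omega>" "W1p_norm \<Omega> q (\<lambda>x. u x - \<phi> x) < \<epsilon>"
    using u e unfolding W01p_space_def norm_closure_in_def by blast
  have le: "A < \<epsilon>" if "(A powr q + B powr q) powr (1 / q) < \<epsilon>" "A \<ge> 0" for A B :: real
  proof -
    have "A = (A powr q) powr (1 / q)" using q that by (simp add: powr_powr)
    also have "\<dots> \<le> (A powr q + B powr q) powr (1 / q)" using q by (intro powr_mono2) auto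
    finally show ?thesis using that by simp
  qed
  have le': "B < \<epsilon>" if "(A powr q + B powr q) powr (1 / q) < \<epsilon>" "B \<ge> 0" for A B :: real
    using le[of B A] that by (simp add: add.commute)
  have "AE x in lebesgue_on \<Omega>. weak_grad \<Omega> (\<lambda>x. u x - \<phi> x) x = weak_grad \<Omega> u x - classical_grad \<phi> x"
    using \<open>open \<Omega>\<close> W1p_spaceD(3)[OF uW] test_function_has_weak_gradient[OF \<Omega> \<phi>(1)] by (rule weak_grad_diff)
  then have ae: "AE x in lebesgue_on \<Omega>. weak_grad \<Omega> u x - classical_grad \<phi> x = weak_grad \<Omega> (\<lambda>x. u x - \<phi> x) x"
    by eventually_elim simp
  have "(\<lambda>x. weak_grad \<Omega> u x - classical_grad \<phi> x) \<in> borel_measurable (lebesgue_on \<Omega>)"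
    using Lp_spaceD(1)[OF W1p_spaceD(2)[OF uW]] Lp_spaceD(1)[OF classical_grad_Lp[OF \<Omega> \<phi>(1) q]]
    by measurable
  from Lp_norm_AE_cong[OF \<Omega> this ae, of q] \<phi>(2)
  have "(Lp_norm \<Omega> q (\<lambda>x. u x - \<phi> x) powr q +
        Lp_norm \<Omega> q (\<lambda>x. weak_grad \<Omega> u x - classical_grad \<phi> x) powr q) powr (1 / q) < \<epsilon>"
    by (simp add: W1p_norm_def)
  then have "Lp_norm \<Omega> q (\<lambda>x. u x - \<phi> x) < \<epsilon>"
      "Lp_norm \<Omega> q (\<lambda>x. weak_grad \<Omega> u x - classical_grad \<phi> x) < \<epsilon>"
    using Lp_norm_nonneg le le' by blast+
  then show ?thesis using that[OF \<phi>(1)] by blast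
qed

section \<open>Antisymmetry of the convective term\<close>

lemma bounded_bilinear_matrix_vector_mult:
  "bounded_bilinear ((*v) :: real^'n^'m \<Rightarrow> real^'n \<Rightarrow> real^'m)"
proof
  show "\<exists>K. \<forall>A x. norm ((A::real^'n^'m) *v x) \<le> norm A * norm x * K"
    by (intro exI[of _ 1]) (simp add: norm_matrix_vector_mult_le)
qed (simp_all add: matrix_vector_mult_add_rdistrib matrix_vector_right_distrib
    scaleR_matrix_vector_assoc matrix_vector_mult_scaleR)

lemma bounded_bilinear_vector_matrix_mult:
  "bounded_bilinear ((v*) :: real^'m \<Rightarrow> real^'n^'m \<Rightarrow> real^'n)"
proof
  show "\<exists>K. \<forall>x A. norm (x v* (A::real^'n^'m)) \<le> norm x * norm A * K"
    by (intro exI[of _ 1]) (simp add: norm_vector_matrix_mult_le)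
qed (simp_all add: vec_eq_iff vector_matrix_mult_def distrib_left distrib_right sum.distrib sum_distrib_left mult_ac)

lemma borel_measurable_bounded_bilinear:
  fixes f :: "'a \<Rightarrow> 'b::{second_countable_topology, real_normed_vector}"
    and g :: "'a \<Rightarrow> 'c::{second_countable_topology, real_normed_vector}"
  assumes h: "bounded_bilinear h" and f: "f \<in> borel_measurable M" and g: "g \<in> borel_measurable M"
  shows "(\<lambda>x. h (f x) (g x)) \<in> borel_measurable M"
  using f g
  by (rule borel_measurable_continuous_Pair)
    (intro bounded_bilinear.continuous_on[OF h] continuous_on_fst continuous_on_snd continuous_on_id)

lemmas borel_measurable_matrix_vector_mult =
  borel_measurable_bounded_bilinear[OF bounded_bilinear_matrix_vector_mult]

lemmas borel_measurable_vector_matrix_mult =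
  borel_measurable_bounded_bilinear[OF bounded_bilinear_vector_matrix_mult]

lemma inner_matrix_vector_mult: "(A *v x) \<bullet> y = (\<Sum>i\<in>UNIV. \<Sum>j\<in>UNIV. A $ i $ j * (x $ j * y $ i))"
  by (simp add: inner_vec_def matrix_vector_mult_def sum_distrib_right mult.assoc)

lemma eq_0_if_arbitrarily_small:
  fixes t C :: real
  assumes "\<And>\<epsilon>. \<epsilon> > 0 \<Longrightarrow> \<bar>t\<bar> \<le> C * \<epsilon>"
  shows "t = 0"
proof (rule ccontr)
  assume "t \<noteq> 0"
  \<comment> \<open>This choice of \<epsilon> leaves at most |t| / 2 on the right;
    \<open>\<bar>C\<bar> + 1\<close> keeps the denominator positive whatever \<open>C\<close>
    is.\<close>
  then have "\<bar>t\<bar> \<le> C * (\<bar>t\<bar> / (2 * (\<bar>C\<bar> + 1)))" by (intro assms) auto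
  also have "\<dots> = C * \<bar>t\<bar> / (2 * (\<bar>C\<bar> + 1))" by simp
  also have "\<dots> \<le> (\<bar>C\<bar> + 1) * \<bar>t\<bar> / (2 * (\<bar>C\<bar> + 1))"
    by (intro divide_right_mono mult_right_mono) auto
  also have "\<dots> = \<bar>t\<bar> / 2" by (simp add: field_simps)
  finally show False using \<open>t \<noteq> 0\<close> by simp
qed

text \<open>The weak gradient of \<open>u\<close> is tested entrywise with the products of the j-th
  component of \<open>\<phi>\<close> and the i-th component of \<open>v\<close>. The product rule
  produces the term with \<open>u\<close> and \<open>v\<close> exchanged, plus
  \<open>u \<bullet> v\<close> times the divergence of \<open>\<phi>\<close>, which is 0.\<close>

lemma convection_antisym_test:
  fixes u v \<phi> :: "real^'d \<Rightarrow> real^'d"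
  assumes \<Omega>: "\<Omega> \<in> sets lebesgue" and G: "has_weak_gradient_on u G \<Omega>"
    and \<phi>: "\<phi> \<in> solenoidal_tests \<Omega>" and v: "v \<in> test_functions \<Omega>"
  shows "(LINT x|lebesgue_on \<Omega>. (G x *v \<phi> x) \<bullet> v x) =
         - (LINT x|lebesgue_on \<Omega>. (classical_grad v x *v \<phi> x) \<bullet> u x)"
proof -
  have \<phi>t: "\<phi> \<in> test_functions \<Omega>" and div: "\<And>x. x \<in> \<Omega> \<Longrightarrow> divergence \<phi> x = 0"
    using \<phi> by (auto simp: solenoidal_tests_def)
  define \<psi> where "\<psi> i j x = \<phi> x $ j * v x $ i" for i j x
  let ?e = "\<lambda>j. axis j (1::real) :: real^'d"
  have \<psi>: "\<psi> i j \<in> test_functions \<Omega>" for i j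
    unfolding \<psi>_def[abs_def]
    by (intro test_function_mult test_function_component[OF \<phi>t] test_function_Ck[OF test_function_component[OF v]])
  have d\<psi>: "frechet_derivative (\<psi> i j) (at x) b =
      \<phi> x $ j * frechet_derivative v (at x) b $ i + frechet_derivative \<phi> (at x) b $ j * v x $ i" for i j x b
  proof -
    have "(\<psi> i j has_derivative (\<lambda>b. \<phi> x $ j * frechet_derivative v (at x) b $ i
        + frechet_derivative \<phi> (at x) b $ j * v x $ i)) (at x)"
      unfolding \<psi>_def[abs_def]
      by (intro has_derivative_mult bounded_linear.has_derivative[OF bounded_linear_vec_nth]
          test_function_has_derivative[OF \<phi>t] test_function_has_derivative[OF v])
    from fun_cong[OF frechet_derivative_at[OF this], of b] show ?thesis by simp
  qed
  have I: "integrable (lebesgue_on \<Omega>) (\<lambda>x. G x $ i $ j * \<psi> i j x)"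
    "integrable (lebesgue_on \<Omega>) (\<lambda>x. u x $ i * frechet_derivative (\<psi> i j) (at x) (?e j))" for i j
    by (rule locally_integrable_times_test(1)[OF \<Omega> weak_gradient_components(2)[OF G] \<psi>],
        rule locally_integrable_times_test(2)[OF \<Omega> weak_gradient_components(1)[OF G] \<psi> axis_1_Basis])
  have "(LINT x|lebesgue_on \<Omega>. (G x *v \<phi> x) \<bullet> v x) =
      (\<Sum>i\<in>UNIV. \<Sum>j\<in>UNIV. LINT x|lebesgue_on \<Omega>. G x $ i $ j * \<psi> i j x)"
    unfolding inner_matrix_vector_mult \<psi>_def[symmetric] using I(1) by simp
  also have "\<dots> = - (\<Sum>i\<in>UNIV. \<Sum>j\<in>UNIV. LINT x|lebesgue_on \<Omega>. u x $ i * frechet_derivative (\<psi> i j) (at x) (?e j))"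
    by (simp add: has_weak_gradient_onD[OF G \<psi>] sum_negf)
  also have "(\<Sum>i\<in>UNIV. \<Sum>j\<in>UNIV. LINT x|lebesgue_on \<Omega>. u x $ i * frechet_derivative (\<psi> i j) (at x) (?e j)) =
      (LINT x|lebesgue_on \<Omega>. (\<Sum>i\<in>UNIV. \<Sum>j\<in>UNIV. u x $ i * frechet_derivative (\<psi> i j) (at x) (?e j)))"
    using I(2) by simp
  also have "\<dots> = (LINT x|lebesgue_on \<Omega>. (classical_grad v x *v \<phi> x) \<bullet> u x)"
  proof (rule Bochner_Integration.integral_cong[OF refl])
    fix x assume "x \<in> space (lebesgue_on \<Omega>)"
    then have 0: "(\<Sum>j\<in>UNIV. frechet_derivative \<phi> (at x) (?e j) $ j) = 0"
      using div[of x] by (simp add: divergence_def)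
    have "(\<Sum>i\<in>UNIV. \<Sum>j\<in>UNIV. u x $ i * frechet_derivative (\<psi> i j) (at x) (?e j)) =
        (\<Sum>i\<in>UNIV. \<Sum>j\<in>UNIV. classical_grad v x $ i $ j * (\<phi> x $ j * u x $ i))
        + (\<Sum>i\<in>UNIV. u x $ i * v x $ i * (\<Sum>j\<in>UNIV. frechet_derivative \<phi> (at x) (?e j) $ j))"
      by (simp add: d\<psi> sum.distrib[symmetric] sum_distrib_left algebra_simps)
    then show "(\<Sum>i\<in>UNIV. \<Sum>j\<in>UNIV. u x $ i * frechet_derivative (\<psi> i j) (at x) (?e j)) =
        (classical_grad v x *v \<phi> x) \<bullet> u x"
      unfolding inner_matrix_vector_mult by (simp add: 0)
  qed
  finally show ?thesis .
qed

lemma test_function_bounded: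
  fixes \<phi> :: "'a::euclidean_space \<Rightarrow> 'b::real_normed_vector"
  assumes "\<phi> \<in> test_functions \<Omega>"
  obtains M where "\<And>x. norm (\<phi> x) \<le> M"
proof -
  obtain K where K: "compact K" "\<And>x. x \<notin> K \<Longrightarrow> \<phi> x = 0"
    using test_functionE[OF assms] by metis
  have "bounded (\<phi> ` K)"
    by (intro compact_imp_bounded compact_continuous_image test_function_continuous[OF assms] K(1))
  then obtain B where B: "\<And>x. x \<in> K \<Longrightarrow> norm (\<phi> x) \<le> B" by (auto simp: bounded_iff)
  have "norm (\<phi> x) \<le> max B 0" for x
    using B[of x] K(2)[of x] by (cases "x \<in> K") auto
  then show ?thesis using that by blast
qed

text \<open>A fixed test field is bounded, so both integrals are continuous in \<open>v\<close> for
  the W^(1,2) norm, in which \<open>v\<close> is by definition a limit of test functions.\<close>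

lemma convection_antisym_solenoidal_test:
  fixes u v \<phi> :: "real^'d \<Rightarrow> real^'d"
  assumes "open \<Omega>" and \<phi>: "\<phi> \<in> solenoidal_tests \<Omega>"
    and u: "u \<in> W1p_space \<Omega> 2" and v: "v \<in> W01p_space \<Omega> 2"
  shows "(LINT x|lebesgue_on \<Omega>. (weak_grad \<Omega> u x *v \<phi> x) \<bullet> v x) =
         - (LINT x|lebesgue_on \<Omega>. (weak_grad \<Omega> v x *v \<phi> x) \<bullet> u x)"
proof -
  have \<Omega>: "\<Omega> \<in> sets lebesgue" using \<open>open \<Omega>\<close> by simp
  have \<phi>t: "\<phi> \<in> test_functions \<Omega>" using \<phi> by (auto simp: solenoidal_tests_def)
  have vW: "v \<in> W1p_space \<Omega> 2" using v by (simp add: W01p_space_def norm_closure_in_def)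
  note uD = W1p_spaceD[OF u] and vD = W1p_spaceD[OF vW]
  have \<phi>m: "\<phi> \<in> borel_measurable (lebesgue_on \<Omega>)" using Lp_spaceD(1)[OF test_function_Lp[OF \<Omega> \<phi>t, of 2]] by simp
  obtain M where M: "\<And>x. norm (\<phi> x) \<le> M" using test_function_bounded[OF \<phi>t] by blast
  have M0: "M \<ge> 0" using M[of 0] norm_ge_zero[of "\<phi> 0"] by linarith
  \<comment> \<open>The bound \<open>M\<close> is absorbed into these factors so that Hoelder's
    inequality with exponents 2 and 2 applies as it stands.\<close>
  define f where "f x = M *\<^sub>R weak_grad \<Omega> u x" for x
  define g where "g x = M *\<^sub>R u x" for x
  have f: "f \<in> Lp_space \<Omega> 2" and g: "g \<in> Lp_space \<Omega> 2"
    using Lp_space_lincomb[OF uD(2) uD(2), of M 0] Lp_space_lincomb[OF uD(1) uD(1), of M 0]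
    by (simp_all add: f_def[abs_def] g_def[abs_def])
  have B1: "integrable (lebesgue_on \<Omega>) (\<lambda>x. (weak_grad \<Omega> u x *v \<phi> x) \<bullet> w x)"
    "\<bar>LINT x|lebesgue_on \<Omega>. (weak_grad \<Omega> u x *v \<phi> x) \<bullet> w x\<bar> \<le> Lp_norm \<Omega> 2 f * Lp_norm \<Omega> 2 w"
    if w: "w \<in> Lp_space \<Omega> 2" for w
  proof -
    have m: "(\<lambda>x. (weak_grad \<Omega> u x *v \<phi> x) \<bullet> w x) \<in> borel_measurable (lebesgue_on \<Omega>)"
      by (intro borel_measurable_inner borel_measurable_matrix_vector_mult Lp_spaceD(1)[OF uD(2)] \<phi>m Lp_spaceD(1)[OF w])
    have b: "\<bar>(weak_grad \<Omega> u x *v \<phi> x) \<bullet> w x\<bar> \<le> norm (f x) * norm (w x)" for x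
    proof -
      have "\<bar>(weak_grad \<Omega> u x *v \<phi> x) \<bullet> w x\<bar> \<le> norm (weak_grad \<Omega> u x *v \<phi> x) * norm (w x)"
        by (rule Cauchy_Schwarz_ineq2)
      also have "norm (weak_grad \<Omega> u x *v \<phi> x) \<le> norm (weak_grad \<Omega> u x) * M"
        using norm_matrix_vector_mult_le[of "weak_grad \<Omega> u x" "\<phi> x"]
          mult_left_mono[OF M[of x], of "norm (weak_grad \<Omega> u x)"] by simp
      finally show ?thesis using M0 by (simp add: f_def mult.commute mult_right_mono)
    qed
    show "integrable (lebesgue_on \<Omega>) (\<lambda>x. (weak_grad \<Omega> u x *v \<phi> x) \<bullet> w x)"
      "\<bar>LINT x|lebesgue_on \<Omega>. (weak_grad \<Omega> u x *v \<phi> x) \<bullet> w x\<bar> \<le> Lp_norm \<Omega> 2 f * Lp_norm \<Omega> 2 w"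
      using Lp_Holder_dominated[OF f w _ _ m b] by simp_all
  qed
  have B2: "integrable (lebesgue_on \<Omega>) (\<lambda>x. (H x *v \<phi> x) \<bullet> u x)"
    "\<bar>LINT x|lebesgue_on \<Omega>. (H x *v \<phi> x) \<bullet> u x\<bar> \<le> Lp_norm \<Omega> 2 H * Lp_norm \<Omega> 2 g"
    if H: "H \<in> Lp_space \<Omega> 2" for H
  proof -
    have m: "(\<lambda>x. (H x *v \<phi> x) \<bullet> u x) \<in> borel_measurable (lebesgue_on \<Omega>)"
      by (intro borel_measurable_inner borel_measurable_matrix_vector_mult Lp_spaceD(1)[OF H] \<phi>m Lp_spaceD(1)[OF uD(1)])
    have b: "\<bar>(H x *v \<phi> x) \<bullet> u x\<bar> \<le> norm (H x) * norm (g x)" for x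
    proof -
      have "\<bar>(H x *v \<phi> x) \<bullet> u x\<bar> \<le> norm (H x *v \<phi> x) * norm (u x)"
        by (rule Cauchy_Schwarz_ineq2)
      also have "norm (H x *v \<phi> x) \<le> norm (H x) * M"
        using norm_matrix_vector_mult_le[of "H x" "\<phi> x"]
          mult_left_mono[OF M[of x], of "norm (H x)"] by simp
      finally show ?thesis using M0 by (simp add: g_def mult.assoc mult_right_mono)
    qed
    show "integrable (lebesgue_on \<Omega>) (\<lambda>x. (H x *v \<phi> x) \<bullet> u x)"
      "\<bar>LINT x|lebesgue_on \<Omega>. (H x *v \<phi> x) \<bullet> u x\<bar> \<le> Lp_norm \<Omega> 2 H * Lp_norm \<Omega> 2 g"
      using Lp_Holder_dominated[OF H g _ _ m b] by simp_all
  qed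
  let ?T = "(LINT x|lebesgue_on \<Omega>. (weak_grad \<Omega> u x *v \<phi> x) \<bullet> v x)
     + (LINT x|lebesgue_on \<Omega>. (weak_grad \<Omega> v x *v \<phi> x) \<bullet> u x)"
  have "?T = 0"
  proof (rule eq_0_if_arbitrarily_small)
    fix \<epsilon> :: real assume "\<epsilon> > 0"
    obtain \<psi> where \<psi>: "\<psi> \<in> test_functions \<Omega>" "Lp_norm \<Omega> 2 (\<lambda>x. v x - \<psi> x) < \<epsilon>"
      "Lp_norm \<Omega> 2 (\<lambda>x. weak_grad \<Omega> v x - classical_grad \<psi> x) < \<epsilon>"
      using W01p_approx[OF \<open>open \<Omega>\<close> v _ \<open>\<epsilon> > 0\<close>] by auto
    have \<psi>L: "\<psi> \<in> Lp_space \<Omega> 2" "classical_grad \<psi> \<in> Lp_space \<Omega> 2"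
      using test_function_Lp[OF \<Omega> \<psi>(1)] classical_grad_Lp[OF \<Omega> \<psi>(1)] by auto
    have dL: "(\<lambda>x. v x - \<psi> x) \<in> Lp_space \<Omega> 2" "(\<lambda>x. weak_grad \<Omega> v x - classical_grad \<psi> x) \<in> Lp_space \<Omega> 2"
      using Lp_space_diff[OF vD(1) \<psi>L(1)] Lp_space_diff[OF vD(2) \<psi>L(2)] by auto
    have "?T = (LINT x|lebesgue_on \<Omega>. (weak_grad \<Omega> u x *v \<phi> x) \<bullet> (v x - \<psi> x))
        + (LINT x|lebesgue_on \<Omega>. ((weak_grad \<Omega> v x - classical_grad \<psi> x) *v \<phi> x) \<bullet> u x)"
      using convection_antisym_test[OF \<Omega> uD(3) \<phi> \<psi>(1)] B1(1)[OF vD(1)] B1(1)[OF \<psi>L(1)] B2(1)[OF vD(2)] B2(1)[OF \<psi>L(2)]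
      by (simp add: inner_diff_right inner_diff_left matrix_vector_mult_diff_rdistrib)
    then have "\<bar>?T\<bar> \<le> Lp_norm \<Omega> 2 f * Lp_norm \<Omega> 2 (\<lambda>x. v x - \<psi> x)
        + Lp_norm \<Omega> 2 (\<lambda>x. weak_grad \<Omega> v x - classical_grad \<psi> x) * Lp_norm \<Omega> 2 g"
      using B1(2)[OF dL(1)] B2(2)[OF dL(2)] by linarith
    also have "\<dots> \<le> Lp_norm \<Omega> 2 f * \<epsilon> + \<epsilon> * Lp_norm \<Omega> 2 g"
      using \<psi> by (intro add_mono mult_left_mono mult_right_mono Lp_norm_nonneg) auto
    finally show "\<bar>?T\<bar> \<le> (Lp_norm \<Omega> 2 f + Lp_norm \<Omega> 2 g) * \<epsilon>" by (simp add: algebra_simps)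
  qed
  then show ?thesis by simp
qed

lemma conjugate_exponent:
  fixes r :: real
  assumes "r > 1"
  shows "1 / r + 1 / (r / (r - 1)) = 1"
  using assms by (simp add: field_simps)

text \<open>The exponent \<open>s\<close> solves 1/2 + 1/s = 1 - 1/r, and s <= r amounts to 4 r <=
  r^2; so \<open>v\<close> is in L^s by interpolation between L^2 and L^r. The first field
  represents the functional sending z to the integral of \<open>(G x *v z x) \<bullet> v x\<close>,
  the second is the density of \<open>op_B\<close>.\<close>

lemma convection_density_Lp:
  fixes v :: "real^'d \<Rightarrow> real^'d" and G :: "real^'d \<Rightarrow> real^'d^'d"
  assumes r: "r \<ge> 4" and G: "G \<in> Lp_space \<Omega> 2" and v: "v \<in> Lp_space \<Omega> 2" "v \<in> Lp_space \<Omega> r"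
  shows "(\<lambda>x. v x v* G x) \<in> Lp_space \<Omega> (r / (r - 1))"
    and "(\<lambda>x. G x *v v x) \<in> Lp_space \<Omega> (r / (r - 1))"
proof -
  define s where "s = 2 * r / (r - 2)"
  have s: "2 \<le> s" "s \<le> r"
    using r mult_left_mono[of 4 r r] by (simp_all add: s_def field_simps)
  have e: "1 / 2 + 1 / s = 1 / (r / (r - 1))" using r by (simp add: s_def field_simps)
  have vs: "v \<in> Lp_space \<Omega> s" using v s by (rule Lp_space_interpolation)
  show "(\<lambda>x. v x v* G x) \<in> Lp_space \<Omega> (r / (r - 1))"
  proof (rule Lp_space_product[OF G vs e])
    show "(\<lambda>x. v x v* G x) \<in> borel_measurable (lebesgue_on \<Omega>)"
      by (intro borel_measurable_vector_matrix_mult Lp_spaceD(1)[OF G] Lp_spaceD(1)[OF vs])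
  qed (use r s norm_vector_matrix_mult_le in \<open>auto simp: mult.commute\<close>)
  show "(\<lambda>x. G x *v v x) \<in> Lp_space \<Omega> (r / (r - 1))"
  proof (rule Lp_space_product[OF G vs e])
    show "(\<lambda>x. G x *v v x) \<in> borel_measurable (lebesgue_on \<Omega>)"
      by (intro borel_measurable_matrix_vector_mult Lp_spaceD(1)[OF G] Lp_spaceD(1)[OF vs])
  qed (use r s norm_matrix_vector_mult_le in auto)
qed

lemma L_sol_approx:
  assumes "z \<in> L_sol \<Omega> r" "\<epsilon> > 0"
  obtains \<phi> where "\<phi> \<in> solenoidal_tests \<Omega>" "Lp_norm \<Omega> r (\<lambda>x. z x - \<phi> x) < \<epsilon>"
  using assms by (auto simp: L_sol_def norm_closure_in_def)

lemma convection_integrable: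
  fixes z v :: "real^'d \<Rightarrow> real^'d"
  assumes r: "r \<ge> 4" and G: "G \<in> Lp_space \<Omega> 2" and v: "v \<in> Lp_space \<Omega> 2" "v \<in> Lp_space \<Omega> r"
    and z: "z \<in> Lp_space \<Omega> r"
  shows "integrable (lebesgue_on \<Omega>) (\<lambda>x. (G x *v z x) \<bullet> v x)"
proof -
  have "integrable (lebesgue_on \<Omega>) (\<lambda>x. z x \<bullet> (v x v* G x))"
    using Lp_inner(1)[OF z convection_density_Lp(1)[OF r G v]] conjugate_exponent[of r] r by simp
  also have "(\<lambda>x. z x \<bullet> (v x v* G x)) = (\<lambda>x. (G x *v z x) \<bullet> v x)"
    by (intro ext) (metis dot_lmul_matrix inner_commute)
  finally show ?thesis .
qed

text \<open>Moving \<open>z\<close> out of the matrix products turns the sum of the two convective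
  integrals into the pairing of \<open>z\<close> with one fixed field \<open>h\<close> in
  L^(r/(r-1)). This pairing is continuous on L^r and vanishes for solenoidal test fields, hence on
  their closure.\<close>

lemma convection_antisym:
  fixes u v z :: "real^'d \<Rightarrow> real^'d"
  assumes "open \<Omega>" and r: "r \<ge> 4" and z: "z \<in> L_sol \<Omega> r"
    and u: "u \<in> W01p_space \<Omega> 2" "u \<in> Lp_space \<Omega> r" and v: "v \<in> W01p_space \<Omega> 2" "v \<in> Lp_space \<Omega> r"
  shows "(LINT x|lebesgue_on \<Omega>. (weak_grad \<Omega> u x *v z x) \<bullet> v x) =
         - (LINT x|lebesgue_on \<Omega>. (weak_grad \<Omega> v x *v z x) \<bullet> u x)"
proof -
  have \<Omega>: "\<Omega> \<in> sets lebesgue" using \<open>open \<Omega>\<close> by simp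
  have W: "u \<in> W1p_space \<Omega> 2" "v \<in> W1p_space \<Omega> 2"
    using u v by (simp_all add: W01p_space_def norm_closure_in_def)
  note uD = W1p_spaceD[OF W(1)] and vD = W1p_spaceD[OF W(2)]
  have zL: "z \<in> Lp_space \<Omega> r" using z by (simp add: L_sol_def norm_closure_in_def)
  \<comment> \<open>The factors 1 give the sum the shape that \<open>Lp_space_lincomb\<close>
    expects.\<close>
  define h where "h x = 1 *\<^sub>R (v x v* weak_grad \<Omega> u x) + 1 *\<^sub>R (u x v* weak_grad \<Omega> v x)" for x
  have h: "h \<in> Lp_space \<Omega> (r / (r - 1))"
    unfolding h_def[abs_def] using r
    by (intro Lp_space_lincomb convection_density_Lp uD vD u v) auto
  have S: "(LINT x|lebesgue_on \<Omega>. (weak_grad \<Omega> u x *v w x) \<bullet> v x)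
      + (LINT x|lebesgue_on \<Omega>. (weak_grad \<Omega> v x *v w x) \<bullet> u x) = (LINT x|lebesgue_on \<Omega>. w x \<bullet> h x)"
    and Sb: "integrable (lebesgue_on \<Omega>) (\<lambda>x. w x \<bullet> h x)"
      "\<bar>LINT x|lebesgue_on \<Omega>. w x \<bullet> h x\<bar> \<le> Lp_norm \<Omega> r w * Lp_norm \<Omega> (r / (r - 1)) h"
    if w: "w \<in> Lp_space \<Omega> r" for w
  proof -
    have I: "integrable (lebesgue_on \<Omega>) (\<lambda>x. (weak_grad \<Omega> u x *v w x) \<bullet> v x)"
       "integrable (lebesgue_on \<Omega>) (\<lambda>x. (weak_grad \<Omega> v x *v w x) \<bullet> u x)"
      by (rule convection_integrable[OF r uD(2) vD(1) v(2) w], rule convection_integrable[OF r vD(2) uD(1) u(2) w])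
    show "(LINT x|lebesgue_on \<Omega>. (weak_grad \<Omega> u x *v w x) \<bullet> v x)
      + (LINT x|lebesgue_on \<Omega>. (weak_grad \<Omega> v x *v w x) \<bullet> u x) = (LINT x|lebesgue_on \<Omega>. w x \<bullet> h x)"
      using I by (simp add: h_def inner_add_right dot_lmul_matrix inner_commute[of "w _"] inner_add_left
          inner_commute[of "_ *v _"])
    show "integrable (lebesgue_on \<Omega>) (\<lambda>x. w x \<bullet> h x)"
      "\<bar>LINT x|lebesgue_on \<Omega>. w x \<bullet> h x\<bar> \<le> Lp_norm \<Omega> r w * Lp_norm \<Omega> (r / (r - 1)) h"
      using Lp_inner[OF w h] conjugate_exponent[of r] r by simp_all
  qed
  have "(LINT x|lebesgue_on \<Omega>. z x \<bullet> h x) = 0"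
  proof (rule eq_0_if_arbitrarily_small)
    fix \<epsilon> :: real assume "\<epsilon> > 0"
    obtain \<phi> where \<phi>: "\<phi> \<in> solenoidal_tests \<Omega>" "Lp_norm \<Omega> r (\<lambda>x. z x - \<phi> x) < \<epsilon>"
      using L_sol_approx[OF z \<open>\<epsilon> > 0\<close>] .
    have \<phi>L: "\<phi> \<in> Lp_space \<Omega> r"
      using \<phi>(1) r by (intro test_function_Lp[OF \<Omega>]) (auto simp: solenoidal_tests_def)
    have "(LINT x|lebesgue_on \<Omega>. \<phi> x \<bullet> h x) = 0"
      using S[OF \<phi>L] convection_antisym_solenoidal_test[OF \<open>open \<Omega>\<close> \<phi>(1) W(1) v(1)] by simp
    then have "(LINT x|lebesgue_on \<Omega>. z x \<bullet> h x) = (LINT x|lebesgue_on \<Omega>. (z x - \<phi> x) \<bullet> h x)"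
      using Sb(1)[OF zL] Sb(1)[OF \<phi>L] by (simp add: inner_diff_left)
    then have "\<bar>LINT x|lebesgue_on \<Omega>. z x \<bullet> h x\<bar>
        \<le> Lp_norm \<Omega> r (\<lambda>x. z x - \<phi> x) * Lp_norm \<Omega> (r / (r - 1)) h"
      using Sb(2)[OF Lp_space_diff[OF zL \<phi>L]] r by simp
    also have "\<dots> \<le> \<epsilon> * Lp_norm \<Omega> (r / (r - 1)) h"
      using \<phi>(2) by (intro mult_right_mono Lp_norm_nonneg) auto
    finally show "\<bar>LINT x|lebesgue_on \<Omega>. z x \<bullet> h x\<bar> \<le> Lp_norm \<Omega> (r / (r - 1)) h * \<epsilon>"
      by (simp add: mult.commute)
  qed
  then show ?thesis using S[OF zL] by simp
qed

section \<open>The operators on the solenoidal spaces\<close>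

lemma integral_lebesgue_on_cong_AE:
  fixes f g :: "'a::euclidean_space \<Rightarrow> real"
  assumes "\<Omega> \<in> sets lebesgue" "f \<in> borel_measurable (lebesgue_on \<Omega>)"
    "AE x in lebesgue_on \<Omega>. f x = g x"
  shows "(LINT x|lebesgue_on \<Omega>. f x) = (LINT x|lebesgue_on \<Omega>. g x)"
  using assms(2) borel_measurable_lebesgue_on_AE[OF assms] assms(3) by (rule integral_cong_AE)

text \<open>The flux grows like the power p - 1 for large gradients but is linear near 0. The linear
  part pairs with L^2, the other lies in L^(p/(p-1)) and pairs with L^p.\<close>

lemma A_weight_bound:
  fixes g :: "'a::real_normed_vector"
  assumes "p \<ge> 2"
  shows "(1 + (norm g)\<^sup>2) powr ((p - 2) / 2) * norm g
           \<le> 2 powr ((p - 2) / 2) * (norm g + norm g powr (p - 1))"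
proof -
  have "(1 + (norm g)\<^sup>2) powr ((p - 2) / 2) \<le>
      2 powr ((p - 2) / 2) * (1 powr ((p - 2) / 2) + ((norm g)\<^sup>2) powr ((p - 2) / 2))"
    using assms by (intro powr_sum_le) auto
  also have "((norm g)\<^sup>2) powr ((p - 2) / 2) = norm g powr (p - 2)"
    using powr_powr[of "norm g" 2 "(p - 2) / 2"] by (simp add: diff_divide_distrib)
  finally have "(1 + (norm g)\<^sup>2) powr ((p - 2) / 2) * norm g
      \<le> 2 powr ((p - 2) / 2) * (1 + norm g powr (p - 2)) * norm g"
    by (intro mult_right_mono) auto
  also have "\<dots> = 2 powr ((p - 2) / 2) * (norm g + norm g powr (p - 2) * norm g)"
    by (simp add: algebra_simps)
  also have "norm g powr (p - 2) * norm g = norm g powr (p - 1)"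
    using powr_add[of "norm g" "p - 2" 1] by simp
  finally show ?thesis .
qed

text \<open>Two applications of Hoelder's inequality, one for each part of the flux; this is why
  both the L^2 and the L^p norm of \<open>H\<close> appear.\<close>

lemma A_pairing:
  fixes G H :: "'a::euclidean_space \<Rightarrow> 'b::euclidean_space"
  assumes p: "p \<ge> 2" and G: "G \<in> Lp_space \<Omega> 2" "G \<in> Lp_space \<Omega> p"
    and H: "H \<in> Lp_space \<Omega> 2" "H \<in> Lp_space \<Omega> p"
  shows "integrable (lebesgue_on \<Omega>) (\<lambda>x. (1 + (norm (G x))\<^sup>2) powr ((p - 2) / 2) * (G x \<bullet> H x))"
    and "\<bar>LINT x|lebesgue_on \<Omega>. (1 + (norm (G x))\<^sup>2) powr ((p - 2) / 2) * (G x \<bullet> H x)\<bar>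
      \<le> 2 powr ((p - 2) / 2) * (Lp_norm \<Omega> 2 G * Lp_norm \<Omega> 2 H
          + Lp_norm \<Omega> (p / (p - 1)) (\<lambda>x. norm (G x) powr (p - 1)) * Lp_norm \<Omega> p H)"
proof -
  let ?c = "2 powr ((p - 2) / 2)"
  let ?k = "\<lambda>x. (1 + (norm (G x))\<^sup>2) powr ((p - 2) / 2) * (G x \<bullet> H x)"
  let ?w = "\<lambda>x. ?c * (norm (G x) * norm (H x) + norm (norm (G x) powr (p - 1)) * norm (H x))"
  have Gp: "(\<lambda>x. norm (G x) powr (p - 1)) \<in> Lp_space \<Omega> (p / (p - 1))"
    using p by (intro Lp_space_powr[OF G(2)]) auto
  have e: "1 / (p / (p - 1)) + 1 / p = 1" "p / (p - 1) > 1" using p by (auto simp: field_simps)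
  note h2 = Lp_Holder[OF G(1) H(1)] and hp = Lp_Holder[OF Gp H(2) e(2) e(1)]
  have h2i: "integrable (lebesgue_on \<Omega>) (\<lambda>x. norm (G x) * norm (H x))"
    and h2b: "(LINT x|lebesgue_on \<Omega>. norm (G x) * norm (H x)) \<le> Lp_norm \<Omega> 2 G * Lp_norm \<Omega> 2 H"
    using h2 by simp_all
  have wi: "integrable (lebesgue_on \<Omega>) ?w"
    by (intro integrable_mult_right Bochner_Integration.integrable_add h2i hp(1))
  have kw: "\<bar>?k x\<bar> \<le> ?w x" for x
  proof -
    have "\<bar>?k x\<bar> \<le> (1 + (norm (G x))\<^sup>2) powr ((p - 2) / 2) * (norm (G x) * norm (H x))"
      using Cauchy_Schwarz_ineq2[of "G x" "H x"] by (simp add: abs_mult mult_left_mono)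
    also have "\<dots> \<le> ?c * (norm (G x) + norm (G x) powr (p - 1)) * norm (H x)"
      using mult_right_mono[OF A_weight_bound[OF p, of "G x"], of "norm (H x)"] by (simp add: mult.assoc)
    finally show ?thesis by (simp add: algebra_simps)
  qed
  have km: "?k \<in> borel_measurable (lebesgue_on \<Omega>)"
    using Lp_spaceD(1)[OF G(1)] Lp_spaceD(1)[OF H(1)] by measurable
  show ki: "integrable (lebesgue_on \<Omega>) ?k"
    using wi km
  proof (rule Bochner_Integration.integrable_bound)
    show "AE x in lebesgue_on \<Omega>. norm (?k x) \<le> norm (?w x)"
      using kw by (intro AE_I2) (simp add: order_trans[OF _ abs_ge_self])
  qed
  have "\<bar>LINT x|lebesgue_on \<Omega>. ?k x\<bar> \<le> (LINT x|lebesgue_on \<Omega>. \<bar>?k x\<bar>)"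
    using integral_norm_bound[of "lebesgue_on \<Omega>" ?k] by simp
  also have "\<dots> \<le> (LINT x|lebesgue_on \<Omega>. ?w x)"
    using ki wi kw by (intro integral_mono) auto
  also have "\<dots> = ?c * ((LINT x|lebesgue_on \<Omega>. norm (G x) * norm (H x))
      + (LINT x|lebesgue_on \<Omega>. norm (norm (G x) powr (p - 1)) * norm (H x)))"
    using h2i hp(1) by simp
  also have "\<dots> \<le> ?c * (Lp_norm \<Omega> 2 G * Lp_norm \<Omega> 2 H
          + Lp_norm \<Omega> (p / (p - 1)) (\<lambda>x. norm (G x) powr (p - 1)) * Lp_norm \<Omega> p H)"
    by (intro mult_left_mono add_mono h2b hp(2)) auto
  finally show "\<bar>LINT x|lebesgue_on \<Omega>. ?k x\<bar> \<le> \<dots>" .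
qed

lemma dual_of_lincomb:
  assumes "f \<in> dual_of X N" "g \<in> dual_of X N"
  shows "(\<lambda>y. a * f y + b * g y) \<in> dual_of X N"
proof -
  obtain C D where C: "\<And>u. u \<in> X \<Longrightarrow> \<bar>f u\<bar> \<le> C * N u" and D: "\<And>u. u \<in> X \<Longrightarrow> \<bar>g u\<bar> \<le> D * N u"
    using assms unfolding dual_of_def by blast
  have "\<bar>a * f u + b * g u\<bar> \<le> (\<bar>a\<bar> * C + \<bar>b\<bar> * D) * N u" if "u \<in> X" for u
  proof -
    have "\<bar>a * f u + b * g u\<bar> \<le> \<bar>a\<bar> * \<bar>f u\<bar> + \<bar>b\<bar> * \<bar>g u\<bar>"
      by (metis abs_mult abs_triangle_ineq)
    also have "\<dots> \<le> \<bar>a\<bar> * (C * N u) + \<bar>b\<bar> * (D * N u)"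
      using C[OF that] D[OF that] by (intro add_mono mult_left_mono) auto
    finally show ?thesis by (simp add: algebra_simps)
  qed
  moreover have "a * f (\<lambda>x. c *\<^sub>R u x + d *\<^sub>R v x) + b * g (\<lambda>x. c *\<^sub>R u x + d *\<^sub>R v x)
      = c * (a * f u + b * g u) + d * (a * f v + b * g v)" if "u \<in> X" "v \<in> X" for u v c d
  proof -
    have "f (\<lambda>x. c *\<^sub>R u x + d *\<^sub>R v x) = c * f u + d * f v"
      "g (\<lambda>x. c *\<^sub>R u x + d *\<^sub>R v x) = c * g u + d * g v"
      using assms that unfolding dual_of_def by blast+
    then show ?thesis by (simp add: algebra_simps)
  qed
  ultimately show ?thesis unfolding dual_of_def by blast
qed

lemma dual_of_L_sol_density:
  fixes k :: "real^'d \<Rightarrow> real^'d"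
  assumes r: "r > 1" and k: "k \<in> Lp_space \<Omega> (r / (r - 1))"
  shows "(\<lambda>y. LINT x|lebesgue_on \<Omega>. k x \<bullet> y x) \<in> dual_of (L_sol \<Omega> r) (Lp_norm \<Omega> r)"
proof -
  have e: "r / (r - 1) > 1" "1 / (r / (r - 1)) + 1 / r = 1"
    using r by (auto simp: field_simps)
  have L: "y \<in> Lp_space \<Omega> r" if "y \<in> L_sol \<Omega> r" for y
    using that by (simp add: L_sol_def norm_closure_in_def)
  note H = Lp_inner[OF k L e]
  have "(LINT x|lebesgue_on \<Omega>. k x \<bullet> (a *\<^sub>R u x + b *\<^sub>R v x)) =
      a * (LINT x|lebesgue_on \<Omega>. k x \<bullet> u x) + b * (LINT x|lebesgue_on \<Omega>. k x \<bullet> v x)"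
    if "u \<in> L_sol \<Omega> r" "v \<in> L_sol \<Omega> r" for u v a b
    using H(1)[OF that(1)] H(1)[OF that(2)] by (simp add: inner_add_right)
  with H(2) show ?thesis unfolding dual_of_def by blast
qed

text \<open>Both cases of the theorem are instances. On a domain of infinite measure L^p is not
  contained in L^2 for p > 2; \<open>V_embedding\<close> provides the L^2 integrability of fields
  and gradients.\<close>

locale damped_flow_spaces =
  fixes \<Omega> :: "(real^'d) set" and p r :: real
  assumes admissible: "admissible_domain \<Omega>" and p: "p \<ge> 2" and r: "r \<ge> 4"
    and V_embedding: "continuously_embedded (V_sol \<Omega> p) (V_norm \<Omega> p) (V_sol \<Omega> 2) (V_norm \<Omega> 2)"
begin

lemma open_domain: "open \<Omega>"
  using admissible by (simp add: admissible_domain_def)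

lemma measurable_domain: "\<Omega> \<in> sets lebesgue"
  using open_domain by simp

lemma V_solD:
  assumes "x \<in> V_sol \<Omega> p"
  shows "x \<in> W01p_space \<Omega> 2" "x \<in> Lp_space \<Omega> 2" "weak_grad \<Omega> x \<in> Lp_space \<Omega> 2"
    "weak_grad \<Omega> x \<in> Lp_space \<Omega> p" "has_weak_gradient_on x (weak_grad \<Omega> x) \<Omega>"
proof -
  have "x \<in> V_sol \<Omega> 2" using assms V_embedding unfolding continuously_embedded_def by blast
  then show W: "x \<in> W01p_space \<Omega> 2" by (simp add: V_sol_def norm_closure_in_def)
  then have "x \<in> W1p_space \<Omega> 2" by (simp add: W01p_space_def norm_closure_in_def)
  from W1p_spaceD[OF this] show "x \<in> Lp_space \<Omega> 2" "weak_grad \<Omega> x \<in> Lp_space \<Omega> 2"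
    "has_weak_gradient_on x (weak_grad \<Omega> x) \<Omega>" by auto
  have "x \<in> W1p_space \<Omega> p" using assms by (simp add: V_sol_def W01p_space_def norm_closure_in_def)
  from W1p_spaceD(2)[OF this] show "weak_grad \<Omega> x \<in> Lp_space \<Omega> p" .
qed

lemma X_solD:
  assumes "x \<in> X_sol \<Omega> p r"
  shows "x \<in> V_sol \<Omega> p" "x \<in> L_sol \<Omega> r" "x \<in> Lp_space \<Omega> r"
  using assms by (auto simp: X_sol_def L_sol_def norm_closure_in_def)

text \<open>The second bound joins the embedding into V to the Poincare inequality with exponent 2.
  It is what makes \<open>op_I\<close> a bounded functional on V_p.\<close>

lemma V_norm_bounds:
  obtains C D where "\<And>y. y \<in> V_sol \<Omega> p \<Longrightarrow> V_norm \<Omega> 2 y \<le> C * V_norm \<Omega> p y"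
    "\<And>y. y \<in> V_sol \<Omega> p \<Longrightarrow> Lp_norm \<Omega> 2 y \<le> D * V_norm \<Omega> p y"
proof -
  obtain C where C: "\<And>y. y \<in> V_sol \<Omega> p \<Longrightarrow> V_norm \<Omega> 2 y \<le> C * V_norm \<Omega> p y"
    using V_embedding unfolding continuously_embedded_def by blast
  have "(2::real) \<ge> 1" by simp
  then obtain c where c: "c > 0" and poincare: "\<And>\<psi>. \<psi> \<in> W01p_space \<Omega> 2 \<Longrightarrow>
      c * (LINT x|lebesgue_on \<Omega>. norm (\<psi> x) powr 2)
        \<le> (LINT x|lebesgue_on \<Omega>. norm (weak_grad \<Omega> \<psi> x) powr 2)"
    using admissible unfolding admissible_domain_def by blast
  have "Lp_norm \<Omega> 2 y \<le> C / sqrt c * V_norm \<Omega> p y" if y: "y \<in> V_sol \<Omega> p" for y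
  proof -
    have "c * (Lp_norm \<Omega> 2 y)\<^sup>2 \<le> (V_norm \<Omega> 2 y)\<^sup>2"
      using poincare[OF V_solD(1)[OF y]] by (simp add: V_norm_def Lp_norm_2_square)
    then have "(sqrt c * Lp_norm \<Omega> 2 y)\<^sup>2 \<le> (V_norm \<Omega> 2 y)\<^sup>2"
      using c by (simp add: power_mult_distrib)
    then have "sqrt c * Lp_norm \<Omega> 2 y \<le> V_norm \<Omega> 2 y"
      by (rule power2_le_imp_le) (simp add: V_norm_def Lp_norm_nonneg)
    then have "Lp_norm \<Omega> 2 y \<le> V_norm \<Omega> 2 y / sqrt c" using c by (simp add: field_simps)
    also have "\<dots> \<le> C * V_norm \<Omega> p y / sqrt c" using C[OF y] c by (intro divide_right_mono) auto
    finally show ?thesis by simp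
  qed
  with C show ?thesis by (rule that)
qed

text \<open>The chosen gradient of a combination is known only almost everywhere; here it is
  exchanged for an explicit representative under the integral.\<close>

lemma op_A_eq:
  assumes x: "x \<in> V_sol \<Omega> p" and H: "H \<in> Lp_space \<Omega> 2"
    and ae: "AE \<xi> in lebesgue_on \<Omega>. weak_grad \<Omega> y \<xi> = H \<xi>"
  shows "op_A \<Omega> p x y = (LINT \<xi>|lebesgue_on \<Omega>.
    (1 + (norm (weak_grad \<Omega> x \<xi>))\<^sup>2) powr ((p - 2) / 2) * (weak_grad \<Omega> x \<xi> \<bullet> H \<xi>))"
  unfolding op_A_def
proof (rule integral_lebesgue_on_cong_AE[OF measurable_domain, symmetric])
  show "(\<lambda>\<xi>. (1 + (norm (weak_grad \<Omega> x \<xi>))\<^sup>2) powr ((p - 2) / 2) * (weak_grad \<Omega> x \<xi> \<bullet> H \<xi>))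
      \<in> borel_measurable (lebesgue_on \<Omega>)"
    using Lp_spaceD(1)[OF V_solD(3)[OF x]] Lp_spaceD(1)[OF H] by measurable
  show "AE \<xi> in lebesgue_on \<Omega>.
      (1 + (norm (weak_grad \<Omega> x \<xi>))\<^sup>2) powr ((p - 2) / 2) * (weak_grad \<Omega> x \<xi> \<bullet> H \<xi>) =
      (1 + (norm (weak_grad \<Omega> x \<xi>))\<^sup>2) powr ((p - 2) / 2) * (weak_grad \<Omega> x \<xi> \<bullet> weak_grad \<Omega> y \<xi>)"
    using ae by eventually_elim simp
qed

lemma op_A_lincomb:
  assumes x: "x \<in> V_sol \<Omega> p" and u: "u \<in> V_sol \<Omega> p" and v: "v \<in> V_sol \<Omega> p"
  shows "op_A \<Omega> p x (\<lambda>\<xi>. a *\<^sub>R u \<xi> + b *\<^sub>R v \<xi>) = a * op_A \<Omega> p x u + b * op_A \<Omega> p x v"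
proof -
  have "op_A \<Omega> p x (\<lambda>\<xi>. a *\<^sub>R u \<xi> + b *\<^sub>R v \<xi>) = (LINT \<xi>|lebesgue_on \<Omega>.
      (1 + (norm (weak_grad \<Omega> x \<xi>))\<^sup>2) powr ((p - 2) / 2) *
      (weak_grad \<Omega> x \<xi> \<bullet> (a *\<^sub>R weak_grad \<Omega> u \<xi> + b *\<^sub>R weak_grad \<Omega> v \<xi>)))"
    by (rule op_A_eq[OF x Lp_space_lincomb[OF V_solD(3)[OF u] V_solD(3)[OF v]]
          weak_grad_lincomb[OF open_domain V_solD(5)[OF u] V_solD(5)[OF v]]]) simp
  also have "\<dots> = (LINT \<xi>|lebesgue_on \<Omega>.
      a * ((1 + (norm (weak_grad \<Omega> x \<xi>))\<^sup>2) powr ((p - 2) / 2) * (weak_grad \<Omega> x \<xi> \<bullet> weak_grad \<Omega> u \<xi>)) +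
      b * ((1 + (norm (weak_grad \<Omega> x \<xi>))\<^sup>2) powr ((p - 2) / 2) * (weak_grad \<Omega> x \<xi> \<bullet> weak_grad \<Omega> v \<xi>)))"
    by (simp add: inner_add_right algebra_simps)
  also have "\<dots> = a * op_A \<Omega> p x u + b * op_A \<Omega> p x v"
    using A_pairing(1)[OF p V_solD(3,4)[OF x] V_solD(3,4)[OF u]] A_pairing(1)[OF p V_solD(3,4)[OF x] V_solD(3,4)[OF v]]
    by (simp add: op_A_def)
  finally show ?thesis .
qed

lemma op_A_dual:
  assumes x: "x \<in> V_sol \<Omega> p"
  shows "op_A \<Omega> p x \<in> dual_of (V_sol \<Omega> p) (V_norm \<Omega> p)"
proof -
  obtain C where C: "\<And>y. y \<in> V_sol \<Omega> p \<Longrightarrow> V_norm \<Omega> 2 y \<le> C * V_norm \<Omega> p y"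
    using V_norm_bounds by metis
  let ?g = "weak_grad \<Omega> x"
  let ?M = "Lp_norm \<Omega> (p / (p - 1)) (\<lambda>\<xi>. norm (?g \<xi>) powr (p - 1))"
  have "\<bar>op_A \<Omega> p x y\<bar> \<le> 2 powr ((p - 2) / 2) * (Lp_norm \<Omega> 2 ?g * C + ?M) * V_norm \<Omega> p y"
    if y: "y \<in> V_sol \<Omega> p" for y
  proof -
    have "\<bar>op_A \<Omega> p x y\<bar> \<le> 2 powr ((p - 2) / 2) * (Lp_norm \<Omega> 2 ?g * V_norm \<Omega> 2 y + ?M * V_norm \<Omega> p y)"
      using A_pairing(2)[OF p V_solD(3,4)[OF x] V_solD(3,4)[OF y]] by (simp add: op_A_def V_norm_def)
    also have "\<dots> \<le> 2 powr ((p - 2) / 2) * (Lp_norm \<Omega> 2 ?g * (C * V_norm \<Omega> p y) + ?M * V_norm \<Omega> p y)"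
      by (intro mult_left_mono add_right_mono C[OF y] Lp_norm_nonneg) auto
    finally show ?thesis by (simp add: algebra_simps)
  qed
  with op_A_lincomb[OF x] show ?thesis unfolding dual_of_def by blast
qed

lemma op_I_dual:
  assumes x: "x \<in> V_sol \<Omega> p"
  shows "op_I \<Omega> x \<in> dual_of (V_sol \<Omega> p) (V_norm \<Omega> p)"
proof -
  obtain D where D: "\<And>y. y \<in> V_sol \<Omega> p \<Longrightarrow> Lp_norm \<Omega> 2 y \<le> D * V_norm \<Omega> p y"
    using V_norm_bounds by metis
  have H: "integrable (lebesgue_on \<Omega>) (\<lambda>\<xi>. x \<xi> \<bullet> y \<xi>)"
      "\<bar>op_I \<Omega> x y\<bar> \<le> Lp_norm \<Omega> 2 x * Lp_norm \<Omega> 2 y" if "y \<in> V_sol \<Omega> p" for y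
    using Lp_inner[OF V_solD(2)[OF x] V_solD(2)[OF that]] by (simp_all add: op_I_def)
  have "\<bar>op_I \<Omega> x y\<bar> \<le> Lp_norm \<Omega> 2 x * D * V_norm \<Omega> p y" if y: "y \<in> V_sol \<Omega> p" for y
    using H(2)[OF y] mult_left_mono[OF D[OF y] Lp_norm_nonneg[of \<Omega> 2 x]] by simp
  moreover have "op_I \<Omega> x (\<lambda>\<xi>. a *\<^sub>R u \<xi> + b *\<^sub>R v \<xi>) = a * op_I \<Omega> x u + b * op_I \<Omega> x v"
    if "u \<in> V_sol \<Omega> p" "v \<in> V_sol \<Omega> p" for u v a b
    using H(1)[OF that(1)] H(1)[OF that(2)] by (simp add: op_I_def inner_add_right)
  ultimately show ?thesis unfolding dual_of_def by blast
qed

lemma op_B_dual: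
  assumes x: "x \<in> X_sol \<Omega> p r"
  shows "op_B \<Omega> x \<in> dual_of (L_sol \<Omega> r) (Lp_norm \<Omega> r)"
proof -
  note V = V_solD[OF X_solD(1)[OF x]]
  show ?thesis
    unfolding op_B_def[abs_def] using r
    by (intro dual_of_L_sol_density convection_density_Lp V X_solD(3)[OF x]) auto
qed

lemma C_density_Lp:
  assumes x: "x \<in> X_sol \<Omega> p r"
  shows "(\<lambda>\<xi>. norm (x \<xi>) powr (r - 2) *\<^sub>R x \<xi>) \<in> Lp_space \<Omega> (r / (r - 1))"
proof (rule Lp_space_dominated)
  note xL = Lp_spaceD[OF X_solD(3)[OF x]]
  show "(\<lambda>\<xi>. norm (x \<xi>) powr (r - 2) *\<^sub>R x \<xi>) \<in> borel_measurable (lebesgue_on \<Omega>)"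
    using xL(1) by measurable
  show "integrable (lebesgue_on \<Omega>) (\<lambda>\<xi>. norm (x \<xi>) powr r)" by (rule xL(2))
  fix \<xi>
  have "norm (norm (x \<xi>) powr (r - 2) *\<^sub>R x \<xi>) = norm (x \<xi>) powr (r - 1)"
    using powr_add[of "norm (x \<xi>)" "r - 2" 1] by simp
  then show "norm (norm (x \<xi>) powr (r - 2) *\<^sub>R x \<xi>) powr (r / (r - 1)) \<le> norm (x \<xi>) powr r"
    using r by (simp add: powr_powr)
qed

lemma op_C_eq: "op_C \<Omega> r x y = (LINT \<xi>|lebesgue_on \<Omega>. (norm (x \<xi>) powr (r - 2) *\<^sub>R x \<xi>) \<bullet> y \<xi>)"
  by (simp add: op_C_def)

lemma op_C_dual:
  assumes "x \<in> X_sol \<Omega> p r"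
  shows "op_C \<Omega> r x \<in> dual_of (L_sol \<Omega> r) (Lp_norm \<Omega> r)"
  unfolding op_C_eq[abs_def] using r C_density_Lp[OF assms] by (intro dual_of_L_sol_density) auto

text \<open>Viscosity and identity are bounded in the V_p norm, convection and damping in the L^r
  norm, which matches the two summands in \<open>X_dual\<close>. The free \<open>\<eta>\<close> lets
  the value 0 serve the case r = 4.\<close>

lemma op_H_dual:
  assumes x: "x \<in> X_sol \<Omega> p r"
  shows "(\<lambda>z. op_H \<Omega> \<mu> \<beta> p r x z + \<eta> * op_I \<Omega> x z) \<in> X_dual \<Omega> p r"
proof -
  have f: "(\<lambda>z. \<mu> * op_A \<Omega> p x z + \<eta> * op_I \<Omega> x z) \<in> dual_of (V_sol \<Omega> p) (V_norm \<Omega> p)"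
    using op_A_dual op_I_dual X_solD(1)[OF x] by (intro dual_of_lincomb) auto
  have g: "(\<lambda>z. 1 * op_B \<Omega> x z + \<beta> * op_C \<Omega> r x z) \<in> dual_of (L_sol \<Omega> r) (Lp_norm \<Omega> r)"
    using op_B_dual[OF x] op_C_dual[OF x] by (rule dual_of_lincomb)
  show ?thesis
    unfolding X_dual_def mem_Collect_eq
    by (rule bexI[OF bexI[OF _ g] f]) (simp add: op_H_def)
qed

section \<open>Differences of the operators, paired with \<open>x - y\<close>\<close>

text \<open>Linearity in the test field leaves only the chosen gradients of \<open>x\<close> and
  \<open>y\<close> in the integrand, the form to which the pointwise inequality applies.\<close>

lemma op_A_diff:
  assumes x: "x \<in> V_sol \<Omega> p" and y: "y \<in> V_sol \<Omega> p"
  defines "k \<equiv> \<lambda>\<xi>. ((1 + (norm (weak_grad \<Omega> x \<xi>))\<^sup>2) powr ((p - 2) / 2) *\<^sub>R weak_grad \<Omega> x \<xi>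
      - (1 + (norm (weak_grad \<Omega> y \<xi>))\<^sup>2) powr ((p - 2) / 2) *\<^sub>R weak_grad \<Omega> y \<xi>)
      \<bullet> (weak_grad \<Omega> x \<xi> - weak_grad \<Omega> y \<xi>)"
  shows "integrable (lebesgue_on \<Omega>) k"
    and "op_A \<Omega> p x (\<lambda>\<xi>. x \<xi> - y \<xi>) - op_A \<Omega> p y (\<lambda>\<xi>. x \<xi> - y \<xi>) = (LINT \<xi>|lebesgue_on \<Omega>. k \<xi>)"
proof -
  let ?W = "\<lambda>g. (1 + (norm g)\<^sup>2) powr ((p - 2) / 2)"
  let ?gx = "weak_grad \<Omega> x" and ?gy = "weak_grad \<Omega> y"
  have k: "k = (\<lambda>\<xi>. (?W (?gx \<xi>) * (?gx \<xi> \<bullet> ?gx \<xi>) - ?W (?gx \<xi>) * (?gx \<xi> \<bullet> ?gy \<xi>))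
      - (?W (?gy \<xi>) * (?gy \<xi> \<bullet> ?gx \<xi>) - ?W (?gy \<xi>) * (?gy \<xi> \<bullet> ?gy \<xi>)))"
    unfolding k_def by (intro ext) (simp add: inner_diff_left inner_diff_right algebra_simps)
  note I = A_pairing(1)[OF p V_solD(3,4)[OF x] V_solD(3,4)[OF x]] A_pairing(1)[OF p V_solD(3,4)[OF x] V_solD(3,4)[OF y]]
    A_pairing(1)[OF p V_solD(3,4)[OF y] V_solD(3,4)[OF x]] A_pairing(1)[OF p V_solD(3,4)[OF y] V_solD(3,4)[OF y]]
  show "integrable (lebesgue_on \<Omega>) k"
    unfolding k by (intro Bochner_Integration.integrable_diff I)
  have "op_A \<Omega> p z (\<lambda>\<xi>. x \<xi> - y \<xi>) = op_A \<Omega> p z x - op_A \<Omega> p z y" if "z \<in> V_sol \<Omega> p" for z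
    using op_A_lincomb[OF that x y, of 1 "-1"] by simp
  then show "op_A \<Omega> p x (\<lambda>\<xi>. x \<xi> - y \<xi>) - op_A \<Omega> p y (\<lambda>\<xi>. x \<xi> - y \<xi>) = (LINT \<xi>|lebesgue_on \<Omega>. k \<xi>)"
    unfolding k using I x y by (simp add: op_A_def)
qed

text \<open>Everything is expanded into trilinear terms in \<open>x\<close> and \<open>y\<close>, so
  integrability and antisymmetry are invoked for these two elements of \<open>X_sol\<close> and
  never for their difference.\<close>

lemma op_B_diff:
  assumes x: "x \<in> X_sol \<Omega> p r" and y: "y \<in> X_sol \<Omega> p r"
  defines "k \<equiv> \<lambda>\<xi>. ((weak_grad \<Omega> x \<xi> - weak_grad \<Omega> y \<xi>) *v (x \<xi> - y \<xi>)) \<bullet> y \<xi>"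
  shows "integrable (lebesgue_on \<Omega>) k"
    and "op_B \<Omega> x (\<lambda>\<xi>. x \<xi> - y \<xi>) - op_B \<Omega> y (\<lambda>\<xi>. x \<xi> - y \<xi>) = - (LINT \<xi>|lebesgue_on \<Omega>. k \<xi>)"
proof -
  define b where "b z u v = (LINT \<xi>|lebesgue_on \<Omega>. (weak_grad \<Omega> u \<xi> *v z \<xi>) \<bullet> v \<xi>)" for z u v
  have I: "integrable (lebesgue_on \<Omega>) (\<lambda>\<xi>. (weak_grad \<Omega> u \<xi> *v z \<xi>) \<bullet> v \<xi>)"
    if "z \<in> X_sol \<Omega> p r" "u \<in> X_sol \<Omega> p r" "v \<in> X_sol \<Omega> p r" for z u v
    using r V_solD X_solD that by (intro convection_integrable[of r]) auto
  have anti: "b z u v = - b z v u"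
    if "z \<in> X_sol \<Omega> p r" "u \<in> X_sol \<Omega> p r" "v \<in> X_sol \<Omega> p r" for z u v
    unfolding b_def using r V_solD X_solD that by (intro convection_antisym[of \<Omega> r] open_domain) auto
  have k: "k = (\<lambda>\<xi>. ((weak_grad \<Omega> x \<xi> *v x \<xi>) \<bullet> y \<xi> - (weak_grad \<Omega> x \<xi> *v y \<xi>) \<bullet> y \<xi>)
      - ((weak_grad \<Omega> y \<xi> *v x \<xi>) \<bullet> y \<xi> - (weak_grad \<Omega> y \<xi> *v y \<xi>) \<bullet> y \<xi>))"
    unfolding k_def
    by (intro ext) (simp add: inner_diff_left matrix_vector_mult_diff_rdistrib matrix_vector_mult_diff_distrib)
  note Ik = I[OF x x y] I[OF y x y] I[OF x y y] I[OF y y y]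
  show "integrable (lebesgue_on \<Omega>) k"
    unfolding k by (intro Bochner_Integration.integrable_diff Ik)
  have "(LINT \<xi>|lebesgue_on \<Omega>. k \<xi>) = b x x y - b y x y - (b x y y - b y y y)"
    unfolding k b_def using Ik by simp
  moreover have "op_B \<Omega> z (\<lambda>\<xi>. x \<xi> - y \<xi>) = b z z x - b z z y" if "z \<in> X_sol \<Omega> p r" for z
    using I[OF that that x] I[OF that that y] by (simp add: op_B_def b_def inner_diff_right)
  \<comment> \<open>Antisymmetry makes \<open>b x x x\<close>, \<open>b y y y\<close> and
    \<open>b x y y\<close> vanish and turns \<open>b y y x\<close> into \<open>- b y x y\<close>;
    both sides become \<open>b y x y - b x x y\<close>.\<close>
  ultimately show "op_B \<Omega> x (\<lambda>\<xi>. x \<xi> - y \<xi>) - op_B \<Omega> y (\<lambda>\<xi>. x \<xi> - y \<xi>) = - (LINT \<xi>|lebesgue_on \<Omega>. k \<xi>)"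
    using anti[OF x x x] anti[OF y y y] anti[OF x y y] anti[OF y x y] x y by simp
qed

lemma op_C_diff:
  assumes x: "x \<in> X_sol \<Omega> p r" and y: "y \<in> X_sol \<Omega> p r"
  defines "k \<equiv> \<lambda>\<xi>. (norm (x \<xi>) powr (r - 2) *\<^sub>R x \<xi> - norm (y \<xi>) powr (r - 2) *\<^sub>R y \<xi>) \<bullet> (x \<xi> - y \<xi>)"
  shows "integrable (lebesgue_on \<Omega>) k"
    and "op_C \<Omega> r x (\<lambda>\<xi>. x \<xi> - y \<xi>) - op_C \<Omega> r y (\<lambda>\<xi>. x \<xi> - y \<xi>) = (LINT \<xi>|lebesgue_on \<Omega>. k \<xi>)"
proof -
  have e: "r / (r - 1) > 1" "1 / (r / (r - 1)) + 1 / r = 1" using r by (auto simp: field_simps)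
  have d: "(\<lambda>\<xi>. x \<xi> - y \<xi>) \<in> Lp_space \<Omega> r"
    using X_solD(3)[OF x] X_solD(3)[OF y] r by (intro Lp_space_diff) auto
  have I: "integrable (lebesgue_on \<Omega>) (\<lambda>\<xi>. (norm (z \<xi>) powr (r - 2) *\<^sub>R z \<xi>) \<bullet> (x \<xi> - y \<xi>))"
    if "z \<in> X_sol \<Omega> p r" for z
    by (rule Lp_inner(1)[OF C_density_Lp[OF that] d e])
  show "integrable (lebesgue_on \<Omega>) k"
    unfolding k_def inner_diff_left[of "_ *\<^sub>R _" "_ *\<^sub>R _"] by (intro Bochner_Integration.integrable_diff I x y)
  show "op_C \<Omega> r x (\<lambda>\<xi>. x \<xi> - y \<xi>) - op_C \<Omega> r y (\<lambda>\<xi>. x \<xi> - y \<xi>) = (LINT \<xi>|lebesgue_on \<Omega>. k \<xi>)"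
    unfolding k_def inner_diff_left[of "_ *\<^sub>R _" "_ *\<^sub>R _"] op_C_eq
    using I[OF x] I[OF y] by (rule Bochner_Integration.integral_diff[symmetric])
qed

text \<open>All terms are gathered into one integrand, which is nonnegative at every point, so no
  integrability of intermediate products such as |y|^2 |x - y|^2 has to be shown. The hypothesis on
  \<open>\<eta>\<close> is the scalar inequality that remains, at t = |y|.\<close>

lemma op_H_lower_bound:
  assumes \<mu>: "\<mu> > 0" and \<beta>: "\<beta> > 0"
    and \<eta>: "\<And>t. t \<ge> 0 \<Longrightarrow> t\<^sup>2 / (4 * \<mu>) \<le> \<beta> / 2 * t powr (r - 2) + \<eta>"
    and x: "x \<in> X_sol \<Omega> p r" and y: "y \<in> X_sol \<Omega> p r"
  shows "op_H \<Omega> \<mu> \<beta> p r x (\<lambda>\<xi>. x \<xi> - y \<xi>) - op_H \<Omega> \<mu> \<beta> p r y (\<lambda>\<xi>. x \<xi> - y \<xi>)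
           + \<eta> * (H_norm \<Omega> (\<lambda>\<xi>. x \<xi> - y \<xi>))\<^sup>2 \<ge> 0"
proof -
  note V = V_solD[OF X_solD(1)[OF x]] V_solD[OF X_solD(1)[OF y]]
  note A = op_A_diff[OF X_solD(1)[OF x] X_solD(1)[OF y]]
  note B = op_B_diff[OF x y] and C = op_C_diff[OF x y]
  let ?w = "\<lambda>\<xi>. x \<xi> - y \<xi>" and ?D = "\<lambda>\<xi>. weak_grad \<Omega> x \<xi> - weak_grad \<Omega> y \<xi>"
  define kA where "kA \<xi> = ((1 + (norm (weak_grad \<Omega> x \<xi>))\<^sup>2) powr ((p - 2) / 2) *\<^sub>R weak_grad \<Omega> x \<xi>
      - (1 + (norm (weak_grad \<Omega> y \<xi>))\<^sup>2) powr ((p - 2) / 2) *\<^sub>R weak_grad \<Omega> y \<xi>) \<bullet> ?D \<xi>" for \<xi>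
  define kB where "kB \<xi> = (?D \<xi> *v ?w \<xi>) \<bullet> y \<xi>" for \<xi>
  define kC where "kC \<xi> = (norm (x \<xi>) powr (r - 2) *\<^sub>R x \<xi> - norm (y \<xi>) powr (r - 2) *\<^sub>R y \<xi>) \<bullet> ?w \<xi>" for \<xi>
  note A = A[folded kA_def] and B = B[folded kB_def] and C = C[folded kC_def]
  have w: "integrable (lebesgue_on \<Omega>) (\<lambda>\<xi>. (norm (?w \<xi>))\<^sup>2)"
    using V by (intro Lp_2_integrable_square Lp_space_diff) auto
  have "op_H \<Omega> \<mu> \<beta> p r x ?w - op_H \<Omega> \<mu> \<beta> p r y ?w + \<eta> * (H_norm \<Omega> ?w)\<^sup>2 =
      \<mu> * (op_A \<Omega> p x ?w - op_A \<Omega> p y ?w) + (op_B \<Omega> x ?w - op_B \<Omega> y ?w)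
      + \<beta> * (op_C \<Omega> r x ?w - op_C \<Omega> r y ?w) + \<eta> * (H_norm \<Omega> ?w)\<^sup>2"
    by (simp add: op_H_def algebra_simps)
  also have "\<dots> = (LINT \<xi>|lebesgue_on \<Omega>. \<mu> * kA \<xi> - kB \<xi> + \<beta> * kC \<xi> + \<eta> * (norm (?w \<xi>))\<^sup>2)"
    using A(1) B(1) C(1) w unfolding A(2) B(2) C(2) H_norm_def Lp_norm_2_square by simp
  also have "\<dots> \<ge> 0"
  proof (rule Bochner_Integration.integral_nonneg)
    fix \<xi>
    let ?d = "norm (?D \<xi>)" and ?v = "norm (?w \<xi>)" and ?t = "norm (y \<xi>)"
    have a: "?d\<^sup>2 \<le> kA \<xi>" unfolding kA_def by (rule A_pointwise_monotone[OF p])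
    have c: "1 / 2 * ?t powr (r - 2) * ?v\<^sup>2 \<le> kC \<xi>"
      unfolding kC_def using r by (intro C_pointwise_monotone) auto
    have "kB \<xi> \<le> norm (?D \<xi> *v ?w \<xi>) * ?t" unfolding kB_def by (rule norm_cauchy_schwarz)
    also have "\<dots> \<le> ?d * ?v * ?t" by (intro mult_right_mono norm_matrix_vector_mult_le) auto
    also have "\<dots> \<le> \<mu> * ?d\<^sup>2 + ?t\<^sup>2 / (4 * \<mu>) * ?v\<^sup>2"
    proof -
      \<comment> \<open>Young's inequality as a completed square. It spends the whole viscous term,
        whence the factor 1/(4 \<mu>).\<close>
      have "0 \<le> (2 * \<mu> * ?d - ?v * ?t)\<^sup>2 / (4 * \<mu>)" using \<mu> by simp
      also have "\<dots> = \<mu> * ?d\<^sup>2 + ?t\<^sup>2 / (4 * \<mu>) * ?v\<^sup>2 - ?d * ?v * ?t"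
        using \<mu> by (simp add: power2_diff power2_eq_square field_simps)
      finally show ?thesis by simp
    qed
    also have "\<dots> \<le> \<mu> * ?d\<^sup>2 + (\<beta> / 2 * ?t powr (r - 2) + \<eta>) * ?v\<^sup>2"
      by (intro add_left_mono mult_right_mono \<eta>) auto
    also have "\<dots> = \<mu> * ?d\<^sup>2 + \<beta> * (1 / 2 * ?t powr (r - 2) * ?v\<^sup>2) + \<eta> * ?v\<^sup>2"
      by (simp add: algebra_simps)
    also have "\<dots> \<le> \<mu> * kA \<xi> + \<beta> * kC \<xi> + \<eta> * ?v\<^sup>2"
      using \<mu> \<beta> by (intro add_right_mono add_mono mult_left_mono a c) auto
    finally show "0 \<le> \<mu> * kA \<xi> - kB \<xi> + \<beta> * kC \<xi> + \<eta> * ?v\<^sup>2" by simp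
  qed
  finally show ?thesis .
qed

text \<open>Links the two forms of part (1): the squared H norm in the inequality is the
  contribution of the identity to the monotone operator.\<close>

lemma op_I_diff:
  assumes x: "x \<in> X_sol \<Omega> p r" and y: "y \<in> X_sol \<Omega> p r"
  shows "op_I \<Omega> x (\<lambda>\<xi>. x \<xi> - y \<xi>) - op_I \<Omega> y (\<lambda>\<xi>. x \<xi> - y \<xi>) = (H_norm \<Omega> (\<lambda>\<xi>. x \<xi> - y \<xi>))\<^sup>2"
proof -
  note V = V_solD(2)[OF X_solD(1)[OF x]] V_solD(2)[OF X_solD(1)[OF y]]
  have d: "(\<lambda>\<xi>. x \<xi> - y \<xi>) \<in> Lp_space \<Omega> 2" using V by (intro Lp_space_diff) auto
  have "integrable (lebesgue_on \<Omega>) (\<lambda>\<xi>. x \<xi> \<bullet> (x \<xi> - y \<xi>))" "integrable (lebesgue_on \<Omega>) (\<lambda>\<xi>. y \<xi> \<bullet> (x \<xi> - y \<xi>))"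
    using Lp_inner(1)[OF V(1) d] Lp_inner(1)[OF V(2) d] by simp_all
  from Bochner_Integration.integral_diff[OF this, symmetric] show ?thesis
    by (simp add: op_I_def H_norm_def Lp_norm_2_square power2_norm_eq_inner inner_diff_left[of "x _" "y _", symmetric])
qed

end

theorem lemma2p3:
  fixes \<Omega> :: "(real^'d) set" and \<mu> \<beta> p r :: real
  assumes "2 \<le> CARD('d)" and "CARD('d) \<le> 4"
    and "admissible_domain \<Omega>"
    and "\<mu> > 0" and "\<beta> > 0" and "p \<ge> 2"
    and "continuously_embedded (V_sol \<Omega> p) (V_norm \<Omega> p) (V_sol \<Omega> 2) (V_norm \<Omega> 2)"
    and "continuously_embedded (X_sol \<Omega> p r) (X_norm \<Omega> p r) (H_sol \<Omega>) (H_norm \<Omega>)"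
  shows "(r > 4 \<longrightarrow>
           (let \<eta> = (r - 4) / (2 * \<mu> * (r - 2)) * (2 / (\<beta> * \<mu> * (r - 2))) powr (2 / (r - 4)) in
              (\<forall>x\<in>X_sol \<Omega> p r. \<forall>y\<in>X_sol \<Omega> p r.
                 op_H \<Omega> \<mu> \<beta> p r x (\<lambda>\<xi>. x \<xi> - y \<xi>) - op_H \<Omega> \<mu> \<beta> p r y (\<lambda>\<xi>. x \<xi> - y \<xi>)
                   + \<eta> * (H_norm \<Omega> (\<lambda>\<xi>. x \<xi> - y \<xi>))\<^sup>2 \<ge> 0) \<and>
              monotone_operator (X_sol \<Omega> p r) (X_dual \<Omega> p r)
                (\<lambda>x z. op_H \<Omega> \<mu> \<beta> p r x z + \<eta> * op_I \<Omega> x z)))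
       \<and> (r = 4 \<and> 2 * \<beta> * \<mu> \<ge> 1 \<longrightarrow>
            monotone_operator (X_sol \<Omega> p 4) (X_dual \<Omega> p 4) (op_H \<Omega> \<mu> \<beta> p 4) \<and>
            (\<forall>x\<in>X_sol \<Omega> p 4. \<forall>y\<in>X_sol \<Omega> p 4.
               op_H \<Omega> \<mu> \<beta> p 4 x (\<lambda>\<xi>. x \<xi> - y \<xi>) - op_H \<Omega> \<mu> \<beta> p 4 y (\<lambda>\<xi>. x \<xi> - y \<xi>) \<ge> 0))"
proof (intro conjI impI)
  assume r4: "r > 4"
  define \<eta> where "\<eta> = (r - 4) / (2 * \<mu> * (r - 2)) * (2 / (\<beta> * \<mu> * (r - 2))) powr (2 / (r - 4))"
  interpret damped_flow_spaces \<Omega> p r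
    using assms r4 by unfold_locales auto
  have lower: "op_H \<Omega> \<mu> \<beta> p r x (\<lambda>\<xi>. x \<xi> - y \<xi>) - op_H \<Omega> \<mu> \<beta> p r y (\<lambda>\<xi>. x \<xi> - y \<xi>)
       + \<eta> * (H_norm \<Omega> (\<lambda>\<xi>. x \<xi> - y \<xi>))\<^sup>2 \<ge> 0"
    if "x \<in> X_sol \<Omega> p r" "y \<in> X_sol \<Omega> p r" for x y
    using square_le_powr_plus_eta[OF r4 assms(4,5)]
    by (intro op_H_lower_bound assms(4,5) that) (simp add: \<eta>_def)
  have "monotone_operator (X_sol \<Omega> p r) (X_dual \<Omega> p r) (\<lambda>x z. op_H \<Omega> \<mu> \<beta> p r x z + \<eta> * op_I \<Omega> x z)"
    unfolding monotone_operator_def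
  proof (intro conjI ballI op_H_dual)
    fix x y assume xy: "x \<in> X_sol \<Omega> p r" "y \<in> X_sol \<Omega> p r"
    show "0 \<le> op_H \<Omega> \<mu> \<beta> p r x (\<lambda>\<xi>. x \<xi> - y \<xi>) + \<eta> * op_I \<Omega> x (\<lambda>\<xi>. x \<xi> - y \<xi>)
      - (op_H \<Omega> \<mu> \<beta> p r y (\<lambda>\<xi>. x \<xi> - y \<xi>) + \<eta> * op_I \<Omega> y (\<lambda>\<xi>. x \<xi> - y \<xi>))"
      using lower[OF xy] unfolding op_I_diff[OF xy, symmetric] by (simp add: right_diff_distrib)
  qed
  with lower show "let \<eta> = (r - 4) / (2 * \<mu> * (r - 2)) * (2 / (\<beta> * \<mu> * (r - 2))) powr (2 / (r - 4)) in
              (\<forall>x\<in>X_sol \<Omega> p r. \<forall>y\<in>X_sol \<Omega> p r.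
                 op_H \<Omega> \<mu> \<beta> p r x (\<lambda>\<xi>. x \<xi> - y \<xi>) - op_H \<Omega> \<mu> \<beta> p r y (\<lambda>\<xi>. x \<xi> - y \<xi>)
                   + \<eta> * (H_norm \<Omega> (\<lambda>\<xi>. x \<xi> - y \<xi>))\<^sup>2 \<ge> 0) \<and>
              monotone_operator (X_sol \<Omega> p r) (X_dual \<Omega> p r)
                (\<lambda>x z. op_H \<Omega> \<mu> \<beta> p r x z + \<eta> * op_I \<Omega> x z)"
    unfolding Let_def \<eta>_def[symmetric] by blast
next
  assume r4: "r = 4 \<and> 2 * \<beta> * \<mu> \<ge> 1"
  \<comment> \<open>The numeral 4 matches the form of the conclusion and lets the exponent 4 - 2 be
    evaluated.\<close>
  interpret damped_flow_spaces \<Omega> p 4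
    using assms r4 by unfold_locales auto
  have "t\<^sup>2 / (4 * \<mu>) \<le> \<beta> / 2 * t powr (4 - 2) + 0" if "t \<ge> 0" for t
  proof -
    \<comment> \<open>Both sides of the scalar inequality are multiples of t^2, and comparing their
      coefficients is exactly the condition 2 \<beta> \<mu> >= 1; so the bound holds with 0 in place
      of \<eta>.\<close>
    have "1 / (4 * \<mu>) \<le> \<beta> / 2" using r4 assms(4) by (simp add: field_simps)
    from mult_right_mono[OF this, of "t\<^sup>2"] show ?thesis using that by simp
  qed
  from op_H_lower_bound[OF assms(4,5) this]
  have lower: "op_H \<Omega> \<mu> \<beta> p 4 x (\<lambda>\<xi>. x \<xi> - y \<xi>) - op_H \<Omega> \<mu> \<beta> p 4 y (\<lambda>\<xi>. x \<xi> - y \<xi>) \<ge> 0"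
    if "x \<in> X_sol \<Omega> p 4" "y \<in> X_sol \<Omega> p 4" for x y
    using that by simp
  then show "\<forall>x\<in>X_sol \<Omega> p 4. \<forall>y\<in>X_sol \<Omega> p 4.
      op_H \<Omega> \<mu> \<beta> p 4 x (\<lambda>\<xi>. x \<xi> - y \<xi>) - op_H \<Omega> \<mu> \<beta> p 4 y (\<lambda>\<xi>. x \<xi> - y \<xi>) \<ge> 0"
    by blast
  with op_H_dual[of _ \<mu> \<beta> 0]
  show "monotone_operator (X_sol \<Omega> p 4) (X_dual \<Omega> p 4) (op_H \<Omega> \<mu> \<beta> p 4)"
    by (simp add: monotone_operator_def)
qed

end
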